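(* Let $n\ge1$ and let $\mathcal{C}_n$ be the $n$-qubit projective Clifford group. The centralizer of $s_1$ in $\mathcal{C}_n$ is $$\mathrm{Cent}_{\mathcal{C}_n}(s_1)=\begin{cases}\langle s_1\rangle,& n=1,\\ \langle h_2,\dots,h_n,\ s_1,s_2,\dots,s_n,\ \Lambda_1,\Lambda_2,\dots,\Lambda_{n-1}\rangle,& n\ge2.\end{cases}$$ Moreover, $\mathrm{Cent}_{\mathcal{C}_n}(s_1)$ is a normal subgroup of $\mathrm{Cent}_{\mathcal{C}_n}(s_1^2)$. If $n\ge2$, then the generator $s_1$ can be omitted from this generating set.
   Context: Let $\omega$ be a primitive 8th root of unity and $Z=\begin{bmatrix}1&0\\0&-1\end{bmatrix}$, $X=\begin{bmatrix}0&1\\1&0\end{bmatrix}$, $H=\frac1{\sqrt2}\begin{bmatrix}1&1\\1&-1\end{bmatrix}$, $S=\begin{bmatrix}1&0\\0&\omega^2\end{bmatrix}$, $CZ=\mathrm{diag}(1,1,1,-1)$. For $U\in\{Z,X,H,S\}$ put $U_i=I_2^{\otimes(i-1)}\otimes U\otimes I_2^{\otimes(n-i)}$, and put $CZ_{i\to i+1}=I_2^{\otimes(i-1)}\otimes CZ\otimes I_2^{\otimes(n-i-1)}$ for $1\le i\le n-1$. The $n$-qubit Pauli group $\mathrm{Pauli}_n$ is the group generated by all $X_i$, $Z_i$ and $\omega^2 I_2^{\otimes n}$. The $n$-qubit Clifford group $\mathrm{Cliff}_n$ is the normalizer of $\mathrm{Pauli}_n$ in the unitary group $U(2^n)$ with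 global phases restricted to powers of $\omega$; it is the finite group generated by $\omega I_2^{\otimes n}$, all $H_i$, all $S_i$ and all $CZ_{i\to i+1}$. The $n$-qubit projective Clifford group is $\mathcal{C}_n=\mathrm{Cliff}_n/\langle\omega I_2^{\otimes n}\rangle$ (equivalently the normalizer of $\mathrm{Pauli}_n$ in $U(2^n)$ modulo all scalars). Write $h_i,s_i,\Lambda_i$ for the classes of $H_i,S_i,CZ_{i\to i+1}$ in $\mathcal{C}_n$; they generate $\mathcal{C}_n$. Convention: products in $\mathcal{C}_n$ are written from left to right (circuit order), i.e. the opposite of matrix multiplication: $[U][V]=[VU]$. For $u\in\mathcal{C}_n$, $\mathrm{Cent}_{\mathcal{C}_n}(u)=\{g\in\mathcal{C}_n: ug=gu\}$. *)

theory Defs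
  imports
    "HOL-Algebra.Group_Action"
    "HOL-Algebra.Generated_Groups"
    "Jordan_Normal_Form.Schur_Decomposition"
begin

definition primitive_unity_root :: "nat \<Rightarrow> complex \<Rightarrow> bool" where
  "primitive_unity_root k w \<longleftrightarrow> k > 0 \<and> w ^ k = 1 \<and> (\<forall>j. 0 < j \<and> j < k \<longrightarrow> w ^ j \<noteq> 1)"

definition kron :: "complex mat \<Rightarrow> complex mat \<Rightarrow> complex mat"  (infixl \<open>\<otimes>\<^sub>k\<close> 70) where
  "A \<otimes>\<^sub>k B = mat (dim_row A * dim_row B) (dim_col A * dim_col B)
     (\<lambda>(r, c). A $$ (r div dim_row B, c div dim_col B) * B $$ (r mod dim_row B, c mod dim_col B))"

primrec kron_pow :: "complex mat \<Rightarrow> nat \<Rightarrow> complex mat" where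
  "kron_pow A 0 = 1\<^sub>m 1"
| "kron_pow A (Suc k) = kron_pow A k \<otimes>\<^sub>k A"

definition Z_gate :: "complex mat" where
  "Z_gate = mat_of_rows_list 2 [[1, 0], [0, -1]]"

definition X_gate :: "complex mat" where
  "X_gate = mat_of_rows_list 2 [[0, 1], [1, 0]]"

definition H_gate :: "complex mat" where
  "H_gate = (1 / complex_of_real (sqrt 2)) \<cdot>\<^sub>m mat_of_rows_list 2 [[1, 1], [1, -1]]"

definition S_gate :: "complex \<Rightarrow> complex mat" where
  "S_gate \<omega> = mat_of_rows_list 2 [[1, 0], [0, \<omega>\<^sup>2]]"

definition CZ_gate :: "complex mat" where
  "CZ_gate = mat_of_rows_list 4 [[1, 0, 0, 0], [0, 1, 0, 0], [0, 0, 1, 0], [0, 0, 0, -1]]"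

text \<open>Qubits are numbered from 1: \<open>on_qubit n i U\<close> is meant for \<open>1 \<le> i \<le> n\<close> and
  \<open>on_qubit_pair n i U\<close>, with \<open>U\<close> acting on the qubits \<open>i\<close> and \<open>i + 1\<close>, for \<open>1 \<le> i \<le> n - 1\<close>.\<close>

definition on_qubit :: "nat \<Rightarrow> nat \<Rightarrow> complex mat \<Rightarrow> complex mat" where
  "on_qubit n i U = kron_pow (1\<^sub>m 2) (i - 1) \<otimes>\<^sub>k U \<otimes>\<^sub>k kron_pow (1\<^sub>m 2) (n - i)"

definition on_qubit_pair :: "nat \<Rightarrow> nat \<Rightarrow> complex mat \<Rightarrow> complex mat" where
  "on_qubit_pair n i U = kron_pow (1\<^sub>m 2) (i - 1) \<otimes>\<^sub>k U \<otimes>\<^sub>k kron_pow (1\<^sub>m 2) (n - i - 1)"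

definition unitary_group :: "nat \<Rightarrow> complex mat monoid" where
  "unitary_group d =
    \<lparr>carrier = {U \<in> carrier_mat d d. U * mat_adjoint U = 1\<^sub>m d \<and> mat_adjoint U * U = 1\<^sub>m d},
     monoid.mult = (*), one = 1\<^sub>m d\<rparr>"

definition pauli_group :: "complex \<Rightarrow> nat \<Rightarrow> complex mat set" where
  "pauli_group \<omega> n = generate (unitary_group (2 ^ n))
     ({on_qubit n i X_gate | i. i \<in> {1..n}} \<union> {on_qubit n i Z_gate | i. i \<in> {1..n}}
      \<union> {\<omega>\<^sup>2 \<cdot>\<^sub>m kron_pow (1\<^sub>m 2) n})"

definition pauli_normalizer :: "complex \<Rightarrow> nat \<Rightarrow> complex mat monoid" where
  "pauli_normalizer \<omega> n =
     (unitary_group (2 ^ n))\<lparr>carrier := normalizer (unitary_group (2 ^ n)) (pauli_group \<omega> n)\<rparr>"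

definition unit_scalars :: "nat \<Rightarrow> complex mat set" where
  "unit_scalars n = {c \<cdot>\<^sub>m 1\<^sub>m (2 ^ n) | c. cmod c = 1}"

text \<open>The projective Clifford group is the normalizer of the Pauli group in \<open>U(2 ^ n)\<close> modulo all
  scalars. The multiplication is reversed, so that products are read in circuit order:
  \<open>[U][V] = [V U]\<close>.\<close>

definition proj_cliff :: "complex \<Rightarrow> nat \<Rightarrow> complex mat set monoid" where
  "proj_cliff \<omega> n = (let Q = pauli_normalizer \<omega> n Mod unit_scalars n
                     in Q\<lparr>monoid.mult := \<lambda>x y. y \<otimes>\<^bsub>Q\<^esub> x\<rparr>)"

definition proj_class :: "complex \<Rightarrow> nat \<Rightarrow> complex mat \<Rightarrow> complex mat set" where
  "proj_class \<omega> n U = unit_scalars n #>\<^bsub>pauli_normalizer \<omega> n\<^esub> U"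

definition h_cls :: "complex \<Rightarrow> nat \<Rightarrow> nat \<Rightarrow> complex mat set" where
  "h_cls \<omega> n i = proj_class \<omega> n (on_qubit n i H_gate)"

definition s_cls :: "complex \<Rightarrow> nat \<Rightarrow> nat \<Rightarrow> complex mat set" where
  "s_cls \<omega> n i = proj_class \<omega> n (on_qubit n i (S_gate \<omega>))"

definition cz_cls :: "complex \<Rightarrow> nat \<Rightarrow> nat \<Rightarrow> complex mat set" where
  "cz_cls \<omega> n i = proj_class \<omega> n (on_qubit_pair n i CZ_gate)"

definition centralizer :: "('a, 'b) monoid_scheme \<Rightarrow> 'a \<Rightarrow> 'a set" where
  "centralizer G u = {g \<in> carrier G. u \<otimes>\<^bsub>G\<^esub> g = g \<otimes>\<^bsub>G\<^esub> u}"

end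

theory Submission
  imports Defs
begin

text \<open>
  Let qubit 1 be the most significant digit of an index. A matrix on \<open>m + 1\<close> qubits is then a two by
  two matrix of blocks of size \<open>2 ^ m\<close>, and with \<open>w = \<omega>\<^sup>2\<close>, \<open>w\<^sup>2 = -1\<close>, the gates \<open>S\<close> and \<open>Z\<close> on
  qubit 1 are \<open>diag(1, w)\<close> and \<open>diag(1, -1)\<close> with scalar blocks.

  A class \<open>[U]\<close> commutes with \<open>s\<^sub>1\<close> iff \<open>U S\<^sub>1 = c S\<^sub>1 U\<close> for a scalar \<open>c\<close>. Comparing blocks, either
  \<open>U\<close> is block diagonal, or it is block antidiagonal and \<open>w\<^sup>2 = 1\<close>; the latter is absurd
  (\<open>commute_first_qubit_cases\<close>). So the centralizer consists of the classes of the block diagonal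
  Clifford matrices \<open>U = diag(A, D)\<close>. Conjugating \<open>X\<^sub>1\<close> by \<open>U\<close> shows that \<open>R = D A\<^sup>\<dagger>\<close> is a Pauli
  matrix, and \<open>U = diag(1, R) (1 \<otimes> A)\<close> where \<open>A\<close> is a Clifford matrix on the remaining qubits
  (\<open>block_diag_clifford\<close>). The matrix \<open>A\<close> is a product of gates on these qubits because the Clifford
  group is generated by \<open>H\<close>, \<open>S\<close>, \<open>CZ\<close> and scalars (\<open>clifford_generated\<close>). The controlled Pauli
  matrix \<open>diag(1, R)\<close> is a power of \<open>S\<^sub>1\<close> if \<open>R\<close> is a scalar. Otherwise circuits on the remaining
  qubits conjugate \<open>R\<close> to a multiple of \<open>Z\<^sub>2\<close> (\<open>pauli_reduces\<close>), and \<open>diag(1, Z\<^sub>2)\<close> is \<open>CZ\<close>.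

  The generation theorem is proved by induction on the number of qubits with the same factorization.
  The Pauli matrix \<open>U Z\<^sub>1 U\<^sup>\<dagger>\<close> is moved back to a multiple of \<open>Z\<^sub>1\<close> by a circuit \<open>G\<close>, so that \<open>G U\<close>
  commutes with \<open>Z\<^sub>1\<close> up to a scalar and is block diagonal, possibly after multiplication by \<open>X\<^sub>1\<close>.

  For at least two qubits \<open>S\<^sub>1\<close> is redundant (\<open>S_first_omitted\<close>): with \<open>Y = S X S\<^sup>\<dagger>\<close> one has
  \<open>Y Z X = w\<close>, hence \<open>diag(1, Y\<^sub>2) diag(1, Z\<^sub>2) diag(1, X\<^sub>2) = diag(1, w) = S\<^sub>1\<close>, and the three factors
  are conjugates of \<open>CZ\<close> by gates on qubit 2.

  As \<open>S\<^sub>1\<^sup>2 = Z\<^sub>1\<close>, the centralizer of \<open>s\<^sub>1\<^sup>2\<close> consists of classes of block diagonal and block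
  antidiagonal matrices. Both kinds normalize the block diagonal matrices, which gives normality
  (\<open>centralizer_s_normal\<close>).
\<close>

section \<open>Matrices of size two and Kronecker products\<close>

notation mat_adjoint (\<open>_\<^sup>\<dagger>\<close> [1000] 999)

lemma index_mat_adjoint [simp]:
  assumes "i < dim_col A" "j < dim_row A"
  shows "A\<^sup>\<dagger> $$ (i, j) = conjugate (A $$ (j, i))"
  using assms by (auto simp: mat_adjoint_def mat_of_rows_index)

lemma dim_mat_adjoint [simp]:
  "dim_row (A\<^sup>\<dagger>) = dim_col A" "dim_col (A\<^sup>\<dagger>) = dim_row A"
  by (auto simp: mat_adjoint_def)

lemma one_smult_mat [simp]: "1 \<cdot>\<^sub>m A = (A :: complex mat)"
  by (rule eq_matI) auto

lemma zero_smult_mat [simp]: "A \<in> carrier_mat n m \<Longrightarrow> 0 \<cdot>\<^sub>m A = (0\<^sub>m n m :: complex mat)"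
  by (rule eq_matI) auto

lemma smult_smult_mat [simp]: "a \<cdot>\<^sub>m (b \<cdot>\<^sub>m A) = (a * b) \<cdot>\<^sub>m (A :: complex mat)"
  by (rule eq_matI) auto

lemma mat_adjoint_carrier [simp]:
  "A \<in> carrier_mat n m \<Longrightarrow> A\<^sup>\<dagger> \<in> carrier_mat m n"
  by auto

lemma mat_adjoint_adjoint [simp]: "(A\<^sup>\<dagger>)\<^sup>\<dagger> = (A :: complex mat)"
  by (rule eq_matI) auto

lemma mat_adjoint_one [simp]: "(1\<^sub>m n)\<^sup>\<dagger> = (1\<^sub>m n :: complex mat)"
  by (rule eq_matI) auto

lemma mat_adjoint_zero [simp]: "(0\<^sub>m n m)\<^sup>\<dagger> = (0\<^sub>m m n :: complex mat)"
  by (rule eq_matI) auto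

lemma mat_adjoint_smult [simp]: "(c \<cdot>\<^sub>m A)\<^sup>\<dagger> = cnj c \<cdot>\<^sub>m (A :: complex mat)\<^sup>\<dagger>"
  by (rule eq_matI) auto

lemma mat_adjoint_mult:
  assumes "A \<in> carrier_mat n m" "B \<in> carrier_mat m k"
  shows "((A :: complex mat) * B)\<^sup>\<dagger> = B\<^sup>\<dagger> * A\<^sup>\<dagger>"
  using assms by (intro eq_matI) (auto simp: scalar_prod_def mult.commute intro!: sum.cong)

lemma mat_adjoint_four_block:
  assumes "A \<in> carrier_mat d d" "B \<in> carrier_mat d d" "C \<in> carrier_mat d d" "D \<in> carrier_mat d d"
  shows "(four_block_mat A B C D)\<^sup>\<dagger> = four_block_mat (A\<^sup>\<dagger>) (C\<^sup>\<dagger>) (B\<^sup>\<dagger>) ((D :: complex mat)\<^sup>\<dagger>)"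
  using assms by (intro eq_matI) auto

lemma four_block_mat_inject:
  assumes "A \<in> carrier_mat d d" "B \<in> carrier_mat d d" "C \<in> carrier_mat d d" "D \<in> carrier_mat d d"
    "A' \<in> carrier_mat d d" "B' \<in> carrier_mat d d" "C' \<in> carrier_mat d d" "D' \<in> carrier_mat d d"
  shows "four_block_mat A B C D = four_block_mat A' B' C' D' \<longleftrightarrow> A = A' \<and> B = B' \<and> C = C' \<and> D = D'"
    (is "?l = ?r \<longleftrightarrow> _")
proof
  assume eq: "?l = ?r"
  have entry: "?l $$ (i, j) = ?r $$ (i, j)" for i j
    by (simp add: eq)
  have "A $$ (i, j) = A' $$ (i, j) \<and> B $$ (i, j) = B' $$ (i, j) \<and>
    C $$ (i, j) = C' $$ (i, j) \<and> D $$ (i, j) = D' $$ (i, j)" if "i < d" "j < d" for i j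
    using entry[of i j] entry[of i "j + d"] entry[of "i + d" j] entry[of "i + d" "j + d"] that assms
    by auto
  with assms show "A = A' \<and> B = B' \<and> C = C' \<and> D = D'"
    by (auto intro!: eq_matI)
qed auto

text \<open>In a square matrix of size \<open>2 * d\<close> the top digit of a row or column index says on which
side of \<open>d\<close> the index lies. With qubit 1 as the most significant digit this is the state of qubit 1.\<close>
lemma four_block_mat_cases:
  assumes "U \<in> carrier_mat (2 * d) (2 * d)"
  obtains A B C D where "A \<in> carrier_mat d d" "B \<in> carrier_mat d d" "C \<in> carrier_mat d d"
    "D \<in> carrier_mat d d" "U = four_block_mat A B C D"
proof
  show "U = four_block_mat (mat d d (\<lambda>(i, j). U $$ (i, j))) (mat d d (\<lambda>(i, j). U $$ (i, j + d)))
      (mat d d (\<lambda>(i, j). U $$ (i + d, j))) (mat d d (\<lambda>(i, j). U $$ (i + d, j + d)))"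
    using assms by (intro eq_matI) auto
qed auto

text \<open>Explicit entries make identities between one-qubit gates a matter of simplification.\<close>
definition mat2 :: "complex \<Rightarrow> complex \<Rightarrow> complex \<Rightarrow> complex \<Rightarrow> complex mat" where
  "mat2 a b c d = mat_of_rows_list 2 [[a, b], [c, d]]"

lemma mat2_carrier [simp]: "mat2 a b c d \<in> carrier_mat 2 2"
  by (auto simp: mat2_def mat_of_rows_list_def)

lemma mat2_dim [simp]: "dim_row (mat2 a b c d) = 2" "dim_col (mat2 a b c d) = 2"
  using mat2_carrier[of a b c d] by blast+

lemma mat2_index [simp]:
  "mat2 a b c d $$ (0, 0) = a" "mat2 a b c d $$ (0, Suc 0) = b"
  "mat2 a b c d $$ (Suc 0, 0) = c" "mat2 a b c d $$ (Suc 0, Suc 0) = d"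
  by (simp_all add: mat2_def mat_of_rows_list_def)

lemma mat2_cases:
  assumes "A \<in> carrier_mat 2 2"
  obtains a b c d where "A = mat2 a b c d"
proof
  show "A = mat2 (A $$ (0, 0)) (A $$ (0, 1)) (A $$ (1, 0)) (A $$ (1, 1))"
    using assms by (intro eq_matI) (auto simp: less_2_cases_iff)
qed

lemma mat2_eq_iff: "mat2 a b c d = mat2 a' b' c' d' \<longleftrightarrow> a = a' \<and> b = b' \<and> c = c' \<and> d = d'"
  by (metis mat2_index)

lemma sum_below_2: "(\<Sum>i = 0..<2. f i) = f 0 + f (Suc 0)" for f :: "nat \<Rightarrow> complex"
  by (simp add: numeral_2_eq_2)

lemma mat2_mult: "mat2 a b c d * mat2 a' b' c' d' =
    mat2 (a * a' + b * c') (a * b' + b * d') (c * a' + d * c') (c * b' + d * d')"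
  by (intro eq_matI) (auto simp: less_2_cases_iff scalar_prod_def sum_below_2)

lemma mat2_smult: "k \<cdot>\<^sub>m mat2 a b c d = mat2 (k * a) (k * b) (k * c) (k * d)"
  by (intro eq_matI) (auto simp: less_2_cases_iff)

lemma mat2_adjoint: "(mat2 a b c d)\<^sup>\<dagger> = mat2 (cnj a) (cnj c) (cnj b) (cnj d)"
  by (intro eq_matI) (auto simp: less_2_cases_iff)

lemma mat2_one: "1\<^sub>m 2 = mat2 1 0 0 1"
  by (intro eq_matI) (auto simp: less_2_cases_iff)

lemmas mat2_simps = mat2_one mat2_mult mat2_smult mat2_adjoint mat2_eq_iff

lemma kron_dim [simp]:
  "dim_row (A \<otimes>\<^sub>k B) = dim_row A * dim_row B" "dim_col (A \<otimes>\<^sub>k B) = dim_col A * dim_col B"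
  by (simp_all add: kron_def)

lemma kron_carrier [simp]:
  "A \<in> carrier_mat a b \<Longrightarrow> B \<in> carrier_mat c d \<Longrightarrow> A \<otimes>\<^sub>k B \<in> carrier_mat (a * c) (b * d)"
  by (auto simp: kron_def)

lemma kron_carrier2 [simp]:
  "A \<in> carrier_mat 2 2 \<Longrightarrow> B \<in> carrier_mat d d \<Longrightarrow> A \<otimes>\<^sub>k B \<in> carrier_mat (2 * d) (2 * d)"
  by simp

lemma kron_index:
  "i < dim_row A * dim_row B \<Longrightarrow> j < dim_col A * dim_col B \<Longrightarrow>
    (A \<otimes>\<^sub>k B) $$ (i, j) =
      A $$ (i div dim_row B, j div dim_col B) * B $$ (i mod dim_row B, j mod dim_col B)"
  by (simp add: kron_def)

text \<open>Writing an index in the mixed radix given by the sizes of the three factors, both sides multiply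
the entries at its three digits.\<close>
lemma kron_assoc: "(A \<otimes>\<^sub>k B) \<otimes>\<^sub>k C = A \<otimes>\<^sub>k (B \<otimes>\<^sub>k C)"
proof (rule eq_matI)
  have bound: "r div z < x * y" "r mod (y * z) < y * z" if "r < x * (y * z)" for r x y z :: nat
  proof -
    show "r div z < x * y"
      using that by (metis less_mult_imp_div_less mult.assoc)
    show "r mod (y * z) < y * z"
      using that by (metis gr_zeroI mod_less_divisor mult_0_right not_less_zero)
  qed
  have digits: "r div z div y = r div (y * z)" "r div z mod y = r mod (y * z) div z"
    "r mod z = r mod (y * z) mod z" for r y z :: nat
  proof -
    show "r div z div y = r div (y * z)"
      by (metis div_mult2_eq mult.commute)
    have split: "r mod (y * z) = z * (r div z mod y) + r mod z"
      by (metis mod_mult2_eq mult.commute)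
    show "r div z mod y = r mod (y * z) div z"
      by (cases "z = 0") (auto simp: split)
    show "r mod z = r mod (y * z) mod z"
      by (simp add: split)
  qed
  fix i j
  assume "i < dim_row (A \<otimes>\<^sub>k (B \<otimes>\<^sub>k C))" "j < dim_col (A \<otimes>\<^sub>k (B \<otimes>\<^sub>k C))"
  then have i: "i < dim_row A * (dim_row B * dim_row C)"
    and j: "j < dim_col A * (dim_col B * dim_col C)" by simp_all
  show "(A \<otimes>\<^sub>k B \<otimes>\<^sub>k C) $$ (i, j) = (A \<otimes>\<^sub>k (B \<otimes>\<^sub>k C)) $$ (i, j)"
    using i j bound[OF i] bound[OF j] 
    by (simp add: kron_index mult.assoc digits(1,2)[symmetric]
        digits(3)[of i "dim_row C" "dim_row B", symmetric] digits(3)[of j "dim_col C" "dim_col B", symmetric])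
qed (simp_all add: mult.assoc)

lemma kron_mat2:
  assumes "Q \<in> carrier_mat d d"
  shows "mat2 a b c e \<otimes>\<^sub>k Q = four_block_mat (a \<cdot>\<^sub>m Q) (b \<cdot>\<^sub>m Q) (c \<cdot>\<^sub>m Q) (e \<cdot>\<^sub>m Q)"
proof (rule eq_matI)
  fix i j
  assume "i < dim_row (four_block_mat (a \<cdot>\<^sub>m Q) (b \<cdot>\<^sub>m Q) (c \<cdot>\<^sub>m Q) (e \<cdot>\<^sub>m Q))"
    "j < dim_col (four_block_mat (a \<cdot>\<^sub>m Q) (b \<cdot>\<^sub>m Q) (c \<cdot>\<^sub>m Q) (e \<cdot>\<^sub>m Q))"
  then have ij: "i < 2 * d" "j < 2 * d"
    using assms by auto
  have digit: "r div d = (if r < d then 0 else Suc 0)" "r mod d = (if r < d then r else r - d)"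
    if "r < 2 * d" for r
  proof -
    show "r div d = (if r < d then 0 else Suc 0)"
      using that by (simp add: div_nat_eqI)
    show "r mod d = (if r < d then r else r - d)"
      using that by (simp add: le_mod_geq)
  qed
  show "(mat2 a b c e \<otimes>\<^sub>k Q) $$ (i, j) =
      four_block_mat (a \<cdot>\<^sub>m Q) (b \<cdot>\<^sub>m Q) (c \<cdot>\<^sub>m Q) (e \<cdot>\<^sub>m Q) $$ (i, j)"
    using assms ij digit[OF ij(1)] digit[OF ij(2)] by (simp add: kron_index)
qed (use assms in auto)

text \<open>The mixed product rule. A left factor of size two turns it into block multiplication, so the
only computation is the collection of scalar factors in each block.\<close>
lemma kron_mult:
  assumes "A \<in> carrier_mat 2 2" "B \<in> carrier_mat 2 2" "P \<in> carrier_mat d d" "Q \<in> carrier_mat d d"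
  shows "(A \<otimes>\<^sub>k P) * (B \<otimes>\<^sub>k Q) = (A * B) \<otimes>\<^sub>k (P * Q)"
proof -
  obtain a b c e where A: "A = mat2 a b c e" using assms(1) by (rule mat2_cases)
  obtain a' b' c' e' where B: "B = mat2 a' b' c' e'" using assms(2) by (rule mat2_cases)
  have entry: "(x \<cdot>\<^sub>m P) * (x' \<cdot>\<^sub>m Q) + (y \<cdot>\<^sub>m P) * (y' \<cdot>\<^sub>m Q) = (x * x' + y * y') \<cdot>\<^sub>m (P * Q)"
    for x x' y y'
    using assms(3,4)
    by (simp add: mult_smult_assoc_mat[of _ d d _ d] mult_smult_distrib[of _ d d _ d] mult.commute
        add_smult_distrib_right_mat[of "P * Q" d d])
  show ?thesis
    unfolding A B mat2_mult using assms(3,4)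
    by (simp add: kron_mat2[of _ d] mult_four_block_mat[of _ d d _ d _ d _ _ d _ d] entry)
qed

lemma kron_adjoint:
  assumes "A \<in> carrier_mat 2 2" "P \<in> carrier_mat d d"
  shows "(A \<otimes>\<^sub>k P)\<^sup>\<dagger> = A\<^sup>\<dagger> \<otimes>\<^sub>k P\<^sup>\<dagger>"
proof -
  obtain a b c e where A: "A = mat2 a b c e" using assms(1) by (rule mat2_cases)
  show ?thesis
    unfolding A mat2_adjoint using assms(2)
    by (simp add: kron_mat2[of _ d] mat_adjoint_four_block[of _ d])
qed

lemma kron_smult_left: "(k \<cdot>\<^sub>m A) \<otimes>\<^sub>k B = k \<cdot>\<^sub>m (A \<otimes>\<^sub>k B)"
proof (rule eq_matI)
  fix i j assume "i < dim_row (k \<cdot>\<^sub>m (A \<otimes>\<^sub>k B))" "j < dim_col (k \<cdot>\<^sub>m (A \<otimes>\<^sub>k B))"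
  then show "((k \<cdot>\<^sub>m A) \<otimes>\<^sub>k B) $$ (i, j) = (k \<cdot>\<^sub>m (A \<otimes>\<^sub>k B)) $$ (i, j)"
    by (simp add: kron_index less_mult_imp_div_less)
qed auto

lemma kron_smult_right: "A \<otimes>\<^sub>k (k \<cdot>\<^sub>m B) = k \<cdot>\<^sub>m (A \<otimes>\<^sub>k B)"
proof (rule eq_matI)
  fix i j assume ij: "i < dim_row (k \<cdot>\<^sub>m (A \<otimes>\<^sub>k B))" "j < dim_col (k \<cdot>\<^sub>m (A \<otimes>\<^sub>k B))"
  then have "i mod dim_row B < dim_row B" "j mod dim_col B < dim_col B"
    by (auto intro!: mod_less_divisor gr0I)
  with ij show "(A \<otimes>\<^sub>k (k \<cdot>\<^sub>m B)) $$ (i, j) = (k \<cdot>\<^sub>m (A \<otimes>\<^sub>k B)) $$ (i, j)"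
    by (simp add: kron_index)
qed auto

lemma kron_one_one: "1\<^sub>m 2 \<otimes>\<^sub>k 1\<^sub>m d = 1\<^sub>m (2 * d)"
proof -
  have "1\<^sub>m 2 \<otimes>\<^sub>k 1\<^sub>m d = four_block_mat (1\<^sub>m d) (0\<^sub>m d d) (0\<^sub>m d d) (1\<^sub>m d)"
    unfolding mat2_one by (simp add: kron_mat2[of _ d] zero_smult_mat[of _ d d])
  then show ?thesis by (simp add: mult_2)
qed

lemma kron_one_left: "1\<^sub>m 1 \<otimes>\<^sub>k A = A"
  by (rule eq_matI) (auto simp: kron_index)

lemma kron_pow_one: "kron_pow (1\<^sub>m 2) k = 1\<^sub>m (2 ^ k)"
proof (induction k)
  case (Suc k)
  have "1\<^sub>m (2 ^ k) \<otimes>\<^sub>k 1\<^sub>m 2 = (1\<^sub>m (2 * 2 ^ k) :: complex mat)"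
  proof (rule eq_matI)
    fix i j :: nat assume "i < dim_row (1\<^sub>m (2 * 2 ^ k) :: complex mat)"
      "j < dim_col (1\<^sub>m (2 * 2 ^ k) :: complex mat)"
    then have ij: "i < 2 * 2 ^ k" "j < 2 * 2 ^ k" by auto
    then have "i div 2 < 2 ^ k" "j div 2 < 2 ^ k" by auto
    moreover have "i = j \<longleftrightarrow> i div 2 = j div 2 \<and> i mod 2 = j mod 2"
      by (metis div_mult_mod_eq)
    ultimately show "(1\<^sub>m (2 ^ k) \<otimes>\<^sub>k 1\<^sub>m 2) $$ (i, j) = (1\<^sub>m (2 * 2 ^ k) :: complex mat) $$ (i, j)"
      using ij by (auto simp: kron_index)
  qed auto
  with Suc show ?case by (simp only: kron_pow.simps power_Suc)
qed simp

section \<open>Unitary matrices and conjugation\<close>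

abbreviation unitary :: "nat \<Rightarrow> complex mat set" where
  "unitary d \<equiv> carrier (unitary_group d)"

lemma unitary_iff:
  "V \<in> unitary d \<longleftrightarrow> V \<in> carrier_mat d d \<and> V * V\<^sup>\<dagger> = 1\<^sub>m d \<and> V\<^sup>\<dagger> * V = 1\<^sub>m d"
  by (simp add: unitary_group_def)

lemma unitaryI:
  "V \<in> carrier_mat d d \<Longrightarrow> V * V\<^sup>\<dagger> = 1\<^sub>m d \<Longrightarrow> V\<^sup>\<dagger> * V = 1\<^sub>m d \<Longrightarrow> V \<in> unitary d"
  by (simp add: unitary_iff)

lemma unitaryD:
  assumes "V \<in> unitary d"
  shows "V * V\<^sup>\<dagger> = 1\<^sub>m d" "V\<^sup>\<dagger> * V = 1\<^sub>m d"
  using assms by (simp_all add: unitary_iff)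

lemma unitary_group_simps [simp]:
  "x \<otimes>\<^bsub>unitary_group d\<^esub> y = x * y" "\<one>\<^bsub>unitary_group d\<^esub> = 1\<^sub>m d"
  by (simp_all add: unitary_group_def)

lemma unitary_carrier_mat [simp, dest]: "V \<in> unitary d \<Longrightarrow> V \<in> carrier_mat d d"
  by (simp add: unitary_iff)

lemma unitary_dim:
  assumes "V \<in> unitary d"
  shows "dim_row V = d" "dim_col V = d"
  using unitary_carrier_mat[OF assms] by auto

lemma unitary_adjoint [simp]: "V \<in> unitary d \<Longrightarrow> V\<^sup>\<dagger> \<in> unitary d"
  by (rule unitaryI) (simp_all add: unitaryD)

lemma unitary_cancel:
  assumes "V \<in> unitary d" "A \<in> carrier_mat d d"
  shows "V * (V\<^sup>\<dagger> * A) = A" "V\<^sup>\<dagger> * (V * A) = A"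
proof -
  have V: "V \<in> carrier_mat d d" using assms by simp
  show "V * (V\<^sup>\<dagger> * A) = A"
    using assms V by (simp add: assoc_mult_mat[symmetric, of _ d d _ d _ d] unitaryD)
  show "V\<^sup>\<dagger> * (V * A) = A"
    using assms V by (simp add: assoc_mult_mat[symmetric, of _ d d _ d _ d] unitaryD)
qed

lemma unitary_mult [simp]:
  assumes "V \<in> unitary d" "W \<in> unitary d"
  shows "V * W \<in> unitary d"
proof -
  have [simp]: "V \<in> carrier_mat d d" "W \<in> carrier_mat d d" using assms by auto
  show ?thesis
    by (rule unitaryI) (simp_all add: mat_adjoint_mult[of _ d d _ d] assoc_mult_mat[of _ d d _ d _ d]
        mult_carrier_mat[of _ d d _ d] unitary_cancel[OF assms(1)] unitary_cancel[OF assms(2)]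
        unitaryD[OF assms(1)] unitaryD[OF assms(2)])
qed

lemma unitary_one [simp]: "1\<^sub>m d \<in> unitary d"
  by (rule unitaryI) simp_all

lemma smult_mult_smult:
  assumes "A \<in> carrier_mat d d" "B \<in> carrier_mat d d"
  shows "(a \<cdot>\<^sub>m A) * (b \<cdot>\<^sub>m B) = (a * b) \<cdot>\<^sub>m (A * (B :: complex mat))"
  using assms by (simp add: mult_smult_assoc_mat[of _ d d _ d] mult_smult_distrib[of _ d d _ d] mult.commute)

lemma cmod_one_iff: "cmod c = 1 \<longleftrightarrow> c * cnj c = 1"
proof -
  have "c * cnj c = complex_of_real ((cmod c)\<^sup>2)"
    using complex_norm_square[of c] by simp
  then have "c * cnj c = 1 \<longleftrightarrow> (cmod c)\<^sup>2 = 1"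
    by (metis of_real_1 of_real_eq_iff)
  then show ?thesis
    by (simp add: abs_square_eq_1)
qed

lemma unitary_smult [simp]:
  assumes "V \<in> unitary d" "cmod c = 1"
  shows "c \<cdot>\<^sub>m V \<in> unitary d"
  using assms unitaryD[OF assms(1)]
  by (intro unitaryI) (simp_all add: smult_mult_smult[of _ d] cmod_one_iff mult.commute)

lemma unitary_group_group: "group (unitary_group d)"
proof (rule groupI)
  fix V assume "V \<in> unitary d"
  then show "\<exists>W\<in>unitary d. W \<otimes>\<^bsub>unitary_group d\<^esub> V = \<one>\<^bsub>unitary_group d\<^esub>"
    by (intro bexI[of _ "V\<^sup>\<dagger>"]) (auto simp: unitaryD)
next
  fix V W Y assume "V \<in> unitary d" "W \<in> unitary d" "Y \<in> unitary d"
  then show "V \<otimes>\<^bsub>unitary_group d\<^esub> W \<otimes>\<^bsub>unitary_group d\<^esub> Y =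
      V \<otimes>\<^bsub>unitary_group d\<^esub> (W \<otimes>\<^bsub>unitary_group d\<^esub> Y)"
    by (simp add: assoc_mult_mat[of _ d d _ d _ d])
qed (auto simp: left_mult_one_mat[OF unitary_carrier_mat])

interpretation unitary_group: group "unitary_group d" for d
  by (rule unitary_group_group)

lemma unitary_inv: "V \<in> unitary d \<Longrightarrow> inv\<^bsub>unitary_group d\<^esub> V = V\<^sup>\<dagger>"
  by (rule unitary_group.inv_equality) (auto simp: unitaryD)

lemma unitary_kron [simp]:
  assumes "A \<in> unitary 2" "V \<in> unitary d"
  shows "A \<otimes>\<^sub>k V \<in> unitary (2 * d)"
  using unitaryD[OF assms(1)] unitaryD[OF assms(2)] assms
  by (intro unitaryI) (simp_all add: kron_adjoint[of _ _ d] kron_mult[of _ _ _ d] kron_one_one)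

lemma unitary_nonzero:
  assumes "V \<in> unitary d" "d > 0"
  shows "V \<noteq> 0\<^sub>m d d"
proof
  assume "V = 0\<^sub>m d d"
  then have "1\<^sub>m d = (0\<^sub>m d d :: complex mat)"
    using unitaryD[OF assms(1)] by simp
  then have "(1\<^sub>m d :: complex mat) $$ (0, 0) = 0\<^sub>m d d $$ (0, 0)" by simp
  with assms(2) show False by simp
qed

lemma smult_eq_zero:
  assumes "a \<cdot>\<^sub>m M = b \<cdot>\<^sub>m M" "a \<noteq> b" "(M :: complex mat) \<in> carrier_mat n m"
  shows "M = 0\<^sub>m n m"
proof (rule eq_matI)
  fix i j assume "i < dim_row (0\<^sub>m n m :: complex mat)" "j < dim_col (0\<^sub>m n m :: complex mat)"
  then have ij: "i < n" "j < m" by auto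
  have "(a \<cdot>\<^sub>m M) $$ (i, j) = (b \<cdot>\<^sub>m M) $$ (i, j)" by (simp add: assms(1))
  then have "a * M $$ (i, j) = b * M $$ (i, j)" using ij assms(3) by simp
  with assms(2) have "M $$ (i, j) = 0" by (metis mult_right_cancel)
  with ij show "M $$ (i, j) = 0\<^sub>m n m $$ (i, j)" by simp
qed (use assms(3) in auto)

text \<open>Unitary matrices are non-zero, so comparing multiples of one compares the scalars. This is how
phases are read off from matrix equations below.\<close>
lemma smult_eq_unitary:
  assumes "a \<cdot>\<^sub>m V = b \<cdot>\<^sub>m V" "V \<in> unitary d" "d > 0"
  shows "a = b"
  using smult_eq_zero[OF assms(1)] unitary_nonzero[OF assms(2,3)] assms(2) by blast

text \<open>Adding an idle first qubit is a group homomorphism; the generation statements use it to pass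
from \<open>m\<close> qubits to qubits \<open>2\<close> to \<open>m + 1\<close>.\<close>
lemma lift_group_hom: "group_hom (unitary_group d) (unitary_group (2 * d)) ((\<otimes>\<^sub>k) (1\<^sub>m 2))"
  by unfold_locales (auto simp: hom_def kron_mult[of _ _ _ d])

definition conj_by :: "complex mat \<Rightarrow> complex mat \<Rightarrow> complex mat" where
  "conj_by V P = V * P * V\<^sup>\<dagger>"

lemma conj_by_carrier [simp]:
  "V \<in> unitary d \<Longrightarrow> P \<in> carrier_mat d d \<Longrightarrow> conj_by V P \<in> carrier_mat d d"
  by (auto simp: conj_by_def intro!: mult_carrier_mat[of _ d d _ d])

lemma conj_by_unitary [simp]:
  "V \<in> unitary d \<Longrightarrow> P \<in> unitary d \<Longrightarrow> conj_by V P \<in> unitary d"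
  by (auto simp: conj_by_def)

lemma conj_by_eq_iff:
  assumes "V \<in> unitary d" "P \<in> carrier_mat d d" "Q \<in> carrier_mat d d"
  shows "conj_by V P = Q \<longleftrightarrow> V * P = Q * V"
proof -
  have V: "V \<in> carrier_mat d d" "V\<^sup>\<dagger> * V = 1\<^sub>m d" "V * V\<^sup>\<dagger> = 1\<^sub>m d"
    using assms(1) by (simp_all add: unitaryD)
  show ?thesis
  proof
    assume "conj_by V P = Q"
    then have "Q * V = V * P * V\<^sup>\<dagger> * V" by (simp add: conj_by_def)
    also have "\<dots> = V * P * (V\<^sup>\<dagger> * V)"
      using V(1) assms(2) by (intro assoc_mult_mat[of _ d d _ d _ d]) auto
    also have "\<dots> = V * P"
      using V(1,2) assms(2) by (simp add: mult_carrier_mat[of _ d d _ d])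
    finally show "V * P = Q * V" ..
  next
    assume "V * P = Q * V"
    then have "conj_by V P = Q * V * V\<^sup>\<dagger>" by (simp add: conj_by_def)
    also have "\<dots> = Q * (V * V\<^sup>\<dagger>)"
      using V(1) assms(3) by (intro assoc_mult_mat[of _ d d _ d _ d]) auto
    finally show "conj_by V P = Q"
      using V(3) assms(3) by simp
  qed
qed

lemma conj_by_smult:
  assumes "V \<in> unitary d" "P \<in> carrier_mat d d"
  shows "conj_by V (c \<cdot>\<^sub>m P) = c \<cdot>\<^sub>m conj_by V P"
  using assms unfolding conj_by_def
  by (simp add: mult_smult_distrib[of _ d d _ d] mult_smult_assoc_mat[of _ d d _ d]
      mult_carrier_mat[of _ d d _ d])

lemma conj_by_comp:
  assumes "V \<in> unitary d" "W \<in> unitary d" "P \<in> carrier_mat d d"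
  shows "conj_by (V * W) P = conj_by V (conj_by W P)"
proof -
  have VW: "V \<in> carrier_mat d d" "W \<in> carrier_mat d d" using assms by auto
  show ?thesis
    unfolding conj_by_def using assms(3) VW
    by (simp add: assoc_mult_mat[of _ d d _ d _ d] mat_adjoint_mult[of _ d d _ d]
        mult_carrier_mat[of _ d d _ d])
qed

lemma conj_by_one [simp]:
  assumes "P \<in> carrier_mat d d"
  shows "conj_by (1\<^sub>m d) P = P"
  using assms by (simp add: conj_by_def)

lemma conj_by_scalar:
  assumes "cmod c = 1" "P \<in> carrier_mat d d"
  shows "conj_by (c \<cdot>\<^sub>m 1\<^sub>m d) P = P"
  using assms
  by (simp add: conj_by_def mult_smult_distrib[of _ d d _ d] mult_smult_assoc_mat[of _ d d _ d]
      cmod_one_iff mult.commute)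

lemma conj_by_of_scalar:
  assumes "V \<in> unitary d"
  shows "conj_by V (c \<cdot>\<^sub>m 1\<^sub>m d) = c \<cdot>\<^sub>m 1\<^sub>m d"
proof -
  have "conj_by V (1\<^sub>m d) = 1\<^sub>m d"
    using assms by (simp add: conj_by_def unitaryD right_mult_one_mat[OF unitary_carrier_mat])
  then show ?thesis using conj_by_smult[OF assms] by simp
qed

lemma conj_by_inverse:
  assumes "V \<in> unitary d" "P \<in> carrier_mat d d"
  shows "conj_by (V\<^sup>\<dagger>) (conj_by V P) = P" "conj_by V (conj_by (V\<^sup>\<dagger>) P) = P"
  using assms conj_by_comp[of "V\<^sup>\<dagger>" d V P] conj_by_comp[of V d "V\<^sup>\<dagger>" P]
  by (simp_all add: unitaryD)

lemma conj_by_kron: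
  assumes "A \<in> unitary 2" "V \<in> unitary d" "B \<in> carrier_mat 2 2" "P \<in> carrier_mat d d"
  shows "conj_by (A \<otimes>\<^sub>k V) (B \<otimes>\<^sub>k P) = conj_by A B \<otimes>\<^sub>k conj_by V P"
  using assms
  by (simp add: conj_by_def kron_adjoint[of _ _ d] kron_mult[of _ _ _ d] mult_carrier_mat[of _ d d _ d]
      mult_carrier_mat[of _ 2 2 _ 2])

section \<open>Blocks with respect to the first qubit\<close>

text \<open>Block diagonal matrices keep the state of qubit 1 in the computational basis, block antidiagonal
ones flip it. For two blocks of the same size these are the two shapes that occur in Pauli matrices
and in matrices commuting projectively with a diagonal gate on qubit 1.\<close>
definition block_diag :: "complex mat \<Rightarrow> complex mat \<Rightarrow> complex mat" where
  "block_diag A D = four_block_mat A (0\<^sub>m (dim_row A) (dim_col D)) (0\<^sub>m (dim_row D) (dim_col A)) D"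

definition block_anti :: "complex mat \<Rightarrow> complex mat \<Rightarrow> complex mat" where
  "block_anti B C = four_block_mat (0\<^sub>m (dim_row B) (dim_col C)) B C (0\<^sub>m (dim_row C) (dim_col B))"

lemma block_four_block:
  assumes "A \<in> carrier_mat d d" "D \<in> carrier_mat d d"
  shows "block_diag A D = four_block_mat A (0\<^sub>m d d) (0\<^sub>m d d) D"
    "block_anti A D = four_block_mat (0\<^sub>m d d) A D (0\<^sub>m d d)"
  using assms by (auto simp: block_diag_def block_anti_def)

lemma block_carrier [simp]:
  assumes "A \<in> carrier_mat d d" "D \<in> carrier_mat d d"
  shows "block_diag A D \<in> carrier_mat (2 * d) (2 * d)" "block_anti A D \<in> carrier_mat (2 * d) (2 * d)"
  using assms by (auto simp: block_diag_def block_anti_def mult_2)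

lemma block_inject:
  assumes "A \<in> carrier_mat d d" "D \<in> carrier_mat d d" "A' \<in> carrier_mat d d" "D' \<in> carrier_mat d d"
  shows "block_diag A D = block_diag A' D' \<longleftrightarrow> A = A' \<and> D = D'"
    "block_anti A D = block_anti A' D' \<longleftrightarrow> A = A' \<and> D = D'"
    "block_diag A D = block_anti A' D' \<longleftrightarrow>
      A = 0\<^sub>m d d \<and> D = 0\<^sub>m d d \<and> A' = 0\<^sub>m d d \<and> D' = 0\<^sub>m d d"
  using assms by (auto simp: block_four_block[of _ d] four_block_mat_inject[of _ d])

lemma block_mult:
  assumes "A \<in> carrier_mat d d" "D \<in> carrier_mat d d" "A' \<in> carrier_mat d d" "D' \<in> carrier_mat d d"
  shows "block_diag A D * block_diag A' D' = block_diag (A * A') (D * D')"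
    "block_diag A D * block_anti A' D' = block_anti (A * A') (D * D')"
    "block_anti A D * block_diag A' D' = block_anti (A * D') (D * A')"
    "block_anti A D * block_anti A' D' = block_diag (A * D') (D * A')"
  using assms
  by (simp_all add: block_four_block[of _ d] mult_four_block_mat[of _ d d _ d _ d _ _ d _ d]
      mult_carrier_mat[of _ d d _ d] left_add_zero_mat[of _ d d] right_add_zero_mat[of _ d d])

lemma block_adjoint:
  assumes "A \<in> carrier_mat d d" "D \<in> carrier_mat d d"
  shows "(block_diag A D)\<^sup>\<dagger> = block_diag (A\<^sup>\<dagger>) (D\<^sup>\<dagger>)" "(block_anti A D)\<^sup>\<dagger> = block_anti (D\<^sup>\<dagger>) (A\<^sup>\<dagger>)"
  using assms by (simp_all add: block_four_block[of _ d] mat_adjoint_four_block[of _ d])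

lemma block_one: "block_diag (1\<^sub>m d) (1\<^sub>m d) = 1\<^sub>m (2 * d)"
  by (simp add: block_four_block[of _ d] mult_2)

lemma block_smult:
  assumes "A \<in> carrier_mat d d" "D \<in> carrier_mat d d"
  shows "c \<cdot>\<^sub>m block_diag A D = block_diag (c \<cdot>\<^sub>m A) (c \<cdot>\<^sub>m D)"
    "c \<cdot>\<^sub>m block_anti A D = block_anti (c \<cdot>\<^sub>m A) (c \<cdot>\<^sub>m D)"
  using assms by (simp_all add: block_four_block[of _ d] smult_four_block_mat[of _ d d _ d _ d])

lemma block_unitary_iff:
  assumes "A \<in> carrier_mat d d" "D \<in> carrier_mat d d"
  shows "block_diag A D \<in> unitary (2 * d) \<longleftrightarrow> A \<in> unitary d \<and> D \<in> unitary d"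
  "block_anti A D \<in> unitary (2 * d) \<longleftrightarrow> A \<in> unitary d \<and> D \<in> unitary d"
proof -
  have c: "A\<^sup>\<dagger> \<in> carrier_mat d d" "D\<^sup>\<dagger> \<in> carrier_mat d d"
    using assms by simp_all
  have p: "A * A\<^sup>\<dagger> \<in> carrier_mat d d" "A\<^sup>\<dagger> * A \<in> carrier_mat d d"
      "D * D\<^sup>\<dagger> \<in> carrier_mat d d" "D\<^sup>\<dagger> * D \<in> carrier_mat d d"
    using assms c by (auto intro: mult_carrier_mat)
  note one = one_carrier_mat[of d]
  show "block_diag A D \<in> unitary (2 * d) \<longleftrightarrow> A \<in> unitary d \<and> D \<in> unitary d"
    unfolding unitary_iff block_adjoint[OF assms] block_mult(1)[OF assms c] block_mult(1)[OF c assms]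
      block_one[symmetric] block_inject(1)[OF p(1,3) one one] block_inject(1)[OF p(2,4) one one]
    using assms block_carrier(1)[OF assms] by blast
  show "block_anti A D \<in> unitary (2 * d) \<longleftrightarrow> A \<in> unitary d \<and> D \<in> unitary d"
    unfolding unitary_iff block_adjoint[OF assms] block_mult(4)[OF assms c(2,1)]
      block_mult(4)[OF c(2,1) assms]
      block_one[symmetric] block_inject(1)[OF p(1,3) one one] block_inject(1)[OF p(4,2) one one]
    using assms block_carrier(2)[OF assms] by blast
qed

lemma kron_block:
  assumes "Q \<in> carrier_mat d d"
  shows "mat2 a 0 0 b \<otimes>\<^sub>k Q = block_diag (a \<cdot>\<^sub>m Q) (b \<cdot>\<^sub>m Q)"
    "mat2 0 a b 0 \<otimes>\<^sub>k Q = block_anti (a \<cdot>\<^sub>m Q) (b \<cdot>\<^sub>m Q)"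
  using assms by (simp_all add: block_four_block[of _ d] kron_mat2[of _ d])

lemma lift_block: "A \<in> carrier_mat d d \<Longrightarrow> 1\<^sub>m 2 \<otimes>\<^sub>k A = block_diag A A"
  unfolding mat2_one by (simp add: kron_block[of _ d])

section \<open>Pauli matrices\<close>

text \<open>Up to signs these are \<open>I\<close>, \<open>Z\<close>, \<open>X\<close> and \<open>X Z\<close>. The real matrix \<open>X Z\<close> takes the place of
\<open>Y\<close>, from which it differs by a fourth root of unity, so that every product of two elements is
an element up to sign.\<close>
definition pauli_basis :: "complex mat set" where
  "pauli_basis = (\<Union>s\<in>{1, -1}. {mat2 1 0 0 s, mat2 0 s 1 0})"

lemma pauli_basis_mult:
  assumes "\<sigma> \<in> pauli_basis" "\<tau> \<in> pauli_basis"
  shows "\<exists>k\<in>{1, -1}. \<exists>\<rho>\<in>pauli_basis. \<sigma> * \<tau> = k \<cdot>\<^sub>m \<rho>"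
  using assms by (auto simp: pauli_basis_def mat2_simps)

lemma pauli_basis_adjoint:
  assumes "\<sigma> \<in> pauli_basis"
  shows "\<exists>k\<in>{1, -1}. \<exists>\<rho>\<in>pauli_basis. \<sigma>\<^sup>\<dagger> = k \<cdot>\<^sub>m \<rho>"
  using assms by (auto simp: pauli_basis_def mat2_simps)

lemma pauli_basis_commute:
  assumes "\<sigma> \<in> pauli_basis" "\<tau> \<in> pauli_basis"
  shows "\<exists>k\<in>{1, -1}. \<sigma> * \<tau> = k \<cdot>\<^sub>m (\<tau> * \<sigma>)"
  using assms by (auto simp: pauli_basis_def mat2_simps)

lemma pauli_basis_unitary: "\<sigma> \<in> pauli_basis \<Longrightarrow> \<sigma> \<in> unitary 2"
  by (auto simp: pauli_basis_def unitary_iff mat2_simps)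

lemma pauli_basis_carrier: "\<sigma> \<in> pauli_basis \<Longrightarrow> \<sigma> \<in> carrier_mat 2 2"
  using pauli_basis_unitary by blast

lemma pauli_basis_one: "1\<^sub>m 2 \<in> pauli_basis"
  by (auto simp: pauli_basis_def mat2_simps)

text \<open>A recursive description of the Pauli group, qubit by qubit. All phases, the fourth roots of unity,
are collected in the last factor; since scalars move freely through a Kronecker product nothing is
lost.\<close>
primrec pauli :: "nat \<Rightarrow> complex mat set" where
  "pauli 0 = {c \<cdot>\<^sub>m 1\<^sub>m 1 | c. c ^ 4 = 1}"
| "pauli (Suc m) = {\<sigma> \<otimes>\<^sub>k Q | \<sigma> Q. \<sigma> \<in> pauli_basis \<and> Q \<in> pauli m}"

lemma pauli_SucI: "\<sigma> \<in> pauli_basis \<Longrightarrow> Q \<in> pauli m \<Longrightarrow> \<sigma> \<otimes>\<^sub>k Q \<in> pauli (Suc m)"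
  by auto

lemma pauli_SucE:
  assumes "P \<in> pauli (Suc m)"
  obtains \<sigma> Q where "\<sigma> \<in> pauli_basis" "Q \<in> pauli m" "P = \<sigma> \<otimes>\<^sub>k Q"
  using assms by auto

declare pauli.simps(2) [simp del]

lemma phase_cmod: "(c :: complex) ^ 4 = 1 \<Longrightarrow> cmod c = 1"
  by (metis norm_ge_zero norm_one norm_power power_eq_1_iff zero_neq_numeral)

lemma pauli_unitary: "P \<in> pauli m \<Longrightarrow> P \<in> unitary (2 ^ m)"
proof (induction m arbitrary: P)
  case 0
  then show ?case using phase_cmod unitary_smult[OF unitary_one] by auto
next
  case (Suc m)
  then show ?case by (elim pauli_SucE) (simp add: pauli_basis_unitary)
qed

lemma pauli_carrier: "P \<in> pauli m \<Longrightarrow> P \<in> carrier_mat (2 ^ m) (2 ^ m)"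
  using pauli_unitary by blast

lemma pauli_smult: "P \<in> pauli m \<Longrightarrow> c ^ 4 = 1 \<Longrightarrow> c \<cdot>\<^sub>m P \<in> pauli m"
proof (induction m arbitrary: P)
  case 0
  then obtain b where "P = b \<cdot>\<^sub>m 1\<^sub>m 1" "b ^ 4 = 1" by auto
  with 0 show ?case by (auto simp: power_mult_distrib intro!: exI[of _ "c * b"])
next
  case (Suc m)
  from Suc.prems(1) show ?case
  proof (rule pauli_SucE)
    fix \<sigma> Q assume "\<sigma> \<in> pauli_basis" "Q \<in> pauli m" "P = \<sigma> \<otimes>\<^sub>k Q"
    then show ?case
      using pauli_SucI[OF _ Suc.IH[of Q]] Suc.prems(2) by (simp flip: kron_smult_right)
  qed
qed

lemma sign_phase: "k \<in> {1, -1} \<Longrightarrow> (k :: complex) ^ 4 = 1"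
  by auto

lemma pauli_SucI_smult:
  assumes "\<sigma> \<in> pauli_basis" "Q \<in> pauli m" "k ^ 4 = 1"
  shows "(k \<cdot>\<^sub>m \<sigma>) \<otimes>\<^sub>k Q \<in> pauli (Suc m)"
  using pauli_smult[OF pauli_SucI[OF assms(1,2)] assms(3)] by (simp add: kron_smult_left)

lemma pauli_mult: "P \<in> pauli m \<Longrightarrow> Q \<in> pauli m \<Longrightarrow> P * Q \<in> pauli m"
proof (induction m arbitrary: P Q)
  case 0
  then obtain a b where "P = a \<cdot>\<^sub>m 1\<^sub>m 1" "a ^ 4 = 1" "Q = b \<cdot>\<^sub>m 1\<^sub>m 1" "b ^ 4 = 1" by auto
  then show ?case by (auto simp: smult_mult_smult[of _ 1] power_mult_distrib)
next
  case (Suc m)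
  from Suc.prems obtain \<sigma> P' \<tau> Q' where P: "\<sigma> \<in> pauli_basis" "P' \<in> pauli m" "P = \<sigma> \<otimes>\<^sub>k P'"
    and Q: "\<tau> \<in> pauli_basis" "Q' \<in> pauli m" "Q = \<tau> \<otimes>\<^sub>k Q'"
    by (elim pauli_SucE)
  obtain k \<rho> where "k \<in> {1, -1}" "\<rho> \<in> pauli_basis" "\<sigma> * \<tau> = k \<cdot>\<^sub>m \<rho>"
    using pauli_basis_mult[OF P(1) Q(1)] by blast
  moreover have "P * Q = (\<sigma> * \<tau>) \<otimes>\<^sub>k (P' * Q')"
    unfolding P(3) Q(3) using P Q pauli_basis_carrier pauli_carrier by (intro kron_mult) auto
  ultimately show ?case
    using Suc.IH[OF P(2) Q(2)] by (simp only: pauli_SucI_smult sign_phase)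
qed

lemma pauli_adjoint: "P \<in> pauli m \<Longrightarrow> P\<^sup>\<dagger> \<in> pauli m"
proof (induction m arbitrary: P)
  case 0
  then obtain a where a: "P = a \<cdot>\<^sub>m 1\<^sub>m 1" "a ^ 4 = 1" by auto
  then have "cnj a ^ 4 = 1" by (metis complex_cnj_one complex_cnj_power)
  with a show ?case by auto
next
  case (Suc m)
  from Suc.prems obtain \<sigma> P' where P: "\<sigma> \<in> pauli_basis" "P' \<in> pauli m" "P = \<sigma> \<otimes>\<^sub>k P'"
    by (elim pauli_SucE)
  obtain k \<rho> where "k \<in> {1, -1}" "\<rho> \<in> pauli_basis" "\<sigma>\<^sup>\<dagger> = k \<cdot>\<^sub>m \<rho>"
    using pauli_basis_adjoint[OF P(1)] by blast
  moreover have "P\<^sup>\<dagger> = \<sigma>\<^sup>\<dagger> \<otimes>\<^sub>k P'\<^sup>\<dagger>"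
    unfolding P(3) using P pauli_basis_carrier pauli_carrier by (intro kron_adjoint) auto
  ultimately show ?case
    using Suc.IH[OF P(2)] by (simp only: pauli_SucI_smult sign_phase)
qed

lemma pauli_commute: "P \<in> pauli m \<Longrightarrow> Q \<in> pauli m \<Longrightarrow> \<exists>k\<in>{1, -1}. P * Q = k \<cdot>\<^sub>m (Q * P)"
proof (induction m arbitrary: P Q)
  case 0
  then obtain a b where "P = a \<cdot>\<^sub>m 1\<^sub>m 1" "Q = b \<cdot>\<^sub>m 1\<^sub>m 1" by auto
  then show ?case by (auto simp: smult_mult_smult[of _ 1] mult.commute)
next
  case (Suc m)
  from Suc.prems obtain \<sigma> P' \<tau> Q' where P: "\<sigma> \<in> pauli_basis" "P' \<in> pauli m" "P = \<sigma> \<otimes>\<^sub>k P'"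
    and Q: "\<tau> \<in> pauli_basis" "Q' \<in> pauli m" "Q = \<tau> \<otimes>\<^sub>k Q'"
    by (elim pauli_SucE)
  note c = pauli_basis_carrier[OF P(1)] pauli_basis_carrier[OF Q(1)]
    pauli_carrier[OF P(2)] pauli_carrier[OF Q(2)]
  obtain k where k: "k \<in> {1, -1}" "\<sigma> * \<tau> = k \<cdot>\<^sub>m (\<tau> * \<sigma>)"
    using pauli_basis_commute[OF P(1) Q(1)] by blast
  obtain l where l: "l \<in> {1, -1}" "P' * Q' = l \<cdot>\<^sub>m (Q' * P')"
    using Suc.IH[OF P(2) Q(2)] by blast
  have "P * Q = (k * l) \<cdot>\<^sub>m (Q * P)"
    unfolding P(3) Q(3) using c k l
    by (simp add: kron_mult[of _ _ _ "2 ^ m"] kron_smult_left kron_smult_right mult.commute)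
  moreover have "k * l \<in> {1, -1}" using k l by auto
  ultimately show ?case by blast
qed

lemma pauli_one: "1\<^sub>m (2 ^ m) \<in> pauli m"
proof (induction m)
  case 0
  show ?case by (auto intro!: exI[of _ 1])
next
  case (Suc m)
  from pauli_SucI[OF pauli_basis_one Suc] show ?case by (simp add: kron_one_one)
qed

text \<open>The form in which membership is used: a Pauli matrix has one of the two block shapes, and both of
its blocks are the same smaller Pauli matrix up to sign.\<close>
lemma pauli_Suc_block:
  assumes "P \<in> pauli (Suc m)"
  obtains Q s where "Q \<in> pauli m" "s \<in> {1, -1}" "P = block_diag Q (s \<cdot>\<^sub>m Q)"
  | Q s where "Q \<in> pauli m" "s \<in> {1, -1}" "P = block_anti (s \<cdot>\<^sub>m Q) Q"
proof -
  obtain \<sigma> Q where *: "\<sigma> \<in> pauli_basis" "Q \<in> pauli m" "P = \<sigma> \<otimes>\<^sub>k Q"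
    using assms by (elim pauli_SucE)
  from *(1) obtain s where "s \<in> {1, -1}" "\<sigma> = mat2 1 0 0 s \<or> \<sigma> = mat2 0 s 1 0"
    by (auto simp: pauli_basis_def)
  then have "P = block_diag Q (s \<cdot>\<^sub>m Q) \<or> P = block_anti (s \<cdot>\<^sub>m Q) Q"
    using pauli_carrier[OF *(2)] *(3) by (auto simp: kron_block[of _ "2 ^ m"])
  with *(2) \<open>s \<in> {1, -1}\<close> show thesis
    using that by blast
qed

lemma pauli_Suc_blockI:
  assumes "Q \<in> pauli m" "s \<in> {1, -1}"
  shows "block_diag Q (s \<cdot>\<^sub>m Q) \<in> pauli (Suc m)" "block_anti (s \<cdot>\<^sub>m Q) Q \<in> pauli (Suc m)"
proof -
  have s: "mat2 1 0 0 s \<in> pauli_basis" "mat2 0 s 1 0 \<in> pauli_basis"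
    using assms(2) by (auto simp: pauli_basis_def)
  show "block_diag Q (s \<cdot>\<^sub>m Q) \<in> pauli (Suc m)" "block_anti (s \<cdot>\<^sub>m Q) Q \<in> pauli (Suc m)"
    using pauli_SucI[OF s(1) assms(1)] pauli_SucI[OF s(2) assms(1)] pauli_carrier[OF assms(1)]
    by (simp_all only: kron_block one_smult_mat)
qed

lemma pauli_nonzero: "Q \<in> pauli m \<Longrightarrow> Q \<noteq> 0\<^sub>m (2 ^ m) (2 ^ m)"
  using unitary_nonzero[OF pauli_unitary] by simp

text \<open>A block diagonal matrix cannot also be block antidiagonal, because the blocks of a Pauli matrix are
unitary and hence non-zero.\<close>
lemma pauli_block_diagD:
  assumes "block_diag A D \<in> pauli (Suc m)" "A \<in> carrier_mat (2 ^ m) (2 ^ m)" "D \<in> carrier_mat (2 ^ m) (2 ^ m)"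
  shows "A \<in> pauli m \<and> (\<exists>s\<in>{1, -1}. D = s \<cdot>\<^sub>m A)"
  using assms(1)
proof (cases rule: pauli_Suc_block)
  case (1 Q s)
  then show ?thesis using assms(2,3) pauli_carrier[OF 1(1)] by (auto simp: block_inject[of _ "2 ^ m"])
next
  case (2 Q s)
  then show ?thesis
    using assms(2,3) pauli_carrier[OF 2(1)] pauli_nonzero[OF 2(1)] by (auto simp: block_inject[of _ "2 ^ m"])
qed

lemma pauli_block_antiD:
  assumes "block_anti A D \<in> pauli (Suc m)" "A \<in> carrier_mat (2 ^ m) (2 ^ m)" "D \<in> carrier_mat (2 ^ m) (2 ^ m)"
  shows "A \<in> pauli m \<and> (\<exists>s\<in>{1, -1}. D = s \<cdot>\<^sub>m A)"
  using assms(1)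
proof (cases rule: pauli_Suc_block)
  case (1 Q s)
  then have "block_diag Q (s \<cdot>\<^sub>m Q) = block_anti A D" by simp
  then show ?thesis
    using assms(2,3) pauli_carrier[OF 1(1)] pauli_nonzero[OF 1(1)] by (auto simp: block_inject[of _ "2 ^ m"])
next
  case (2 Q s)
  then have "A = s \<cdot>\<^sub>m Q" "D = Q"
    using assms(2,3) pauli_carrier[OF 2(1)] by (auto simp: block_inject[of _ "2 ^ m"])
  with 2 show ?thesis
    using pauli_smult[OF 2(1) sign_phase[OF 2(2)]] by (auto intro: bexI[of _ s])
qed

section \<open>Clifford matrices\<close>

text \<open>Requiring stability under conjugation by \<open>V\<close> and by its adjoint expresses that conjugation by \<open>V\<close>
maps the Pauli matrices onto themselves.\<close>
definition clifford :: "nat \<Rightarrow> complex mat set" where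
  "clifford m = {V \<in> unitary (2 ^ m).
     \<forall>P\<in>pauli m. conj_by V P \<in> pauli m \<and> conj_by (V\<^sup>\<dagger>) P \<in> pauli m}"

lemma cliffordD:
  assumes "V \<in> clifford m"
  shows "V \<in> unitary (2 ^ m)" "P \<in> pauli m \<Longrightarrow> conj_by V P \<in> pauli m"
    "P \<in> pauli m \<Longrightarrow> conj_by (V\<^sup>\<dagger>) P \<in> pauli m"
  using assms by (auto simp: clifford_def)

lemma clifford_carrier: "V \<in> clifford m \<Longrightarrow> V \<in> carrier_mat (2 ^ m) (2 ^ m)"
  using cliffordD(1) by blast

lemma clifford_adjoint: "V \<in> clifford m \<Longrightarrow> V\<^sup>\<dagger> \<in> clifford m"
  by (simp add: clifford_def)

lemma clifford_mult:
  assumes "V \<in> clifford m" "W \<in> clifford m"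
  shows "V * W \<in> clifford m"
proof -
  note V = cliffordD[OF assms(1)] and W = cliffordD[OF assms(2)]
  have "conj_by (V * W) P \<in> pauli m \<and> conj_by ((V * W)\<^sup>\<dagger>) P \<in> pauli m" if "P \<in> pauli m" for P
    using that V W clifford_carrier[OF assms(1)] clifford_carrier[OF assms(2)] pauli_carrier[OF that]
    by (simp add: conj_by_comp[of _ "2 ^ m"] mat_adjoint_mult[of _ "2 ^ m" "2 ^ m" _ "2 ^ m"])
  with V(1) W(1) show ?thesis by (simp add: clifford_def)
qed

lemma clifford_scalar:
  assumes "cmod c = 1"
  shows "c \<cdot>\<^sub>m 1\<^sub>m (2 ^ m) \<in> clifford m"
  using assms pauli_carrier by (auto simp: clifford_def conj_by_scalar[of _ _ "2 ^ m"])

lemma clifford_one: "1\<^sub>m (2 ^ m) \<in> clifford m"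
  using clifford_scalar[of 1 m] by simp

lemma clifford_subgroup: "subgroup (clifford m) (unitary_group (2 ^ m))"
  by (intro unitary_group.subgroupI)
    (auto simp: cliffordD(1) unitary_inv clifford_adjoint clifford_mult intro: clifford_one)

lemma clifford_lift:
  assumes "A \<in> clifford m"
  shows "1\<^sub>m 2 \<otimes>\<^sub>k A \<in> clifford (Suc m)"
proof -
  have "conj_by (1\<^sub>m 2 \<otimes>\<^sub>k V) P \<in> pauli (Suc m)" if "V \<in> clifford m" "P \<in> pauli (Suc m)" for V P
    using that(2)
  proof (rule pauli_SucE)
    fix \<sigma> Q assume *: "\<sigma> \<in> pauli_basis" "Q \<in> pauli m" "P = \<sigma> \<otimes>\<^sub>k Q"
    then have "conj_by (1\<^sub>m 2 \<otimes>\<^sub>k V) P = \<sigma> \<otimes>\<^sub>k conj_by V Q"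
      using cliffordD(1)[OF that(1)] pauli_basis_carrier[OF *(1)] pauli_carrier[OF *(2)]
      by (simp add: conj_by_kron[of _ _ "2 ^ m"])
    with * show ?thesis using pauli_SucI[OF *(1)] cliffordD(2)[OF that(1)] by simp
  qed
  moreover have "(1\<^sub>m 2 \<otimes>\<^sub>k A)\<^sup>\<dagger> = 1\<^sub>m 2 \<otimes>\<^sub>k A\<^sup>\<dagger>"
    using clifford_carrier[OF assms] by (simp add: kron_adjoint[of _ _ "2 ^ m"])
  ultimately show ?thesis
    using assms cliffordD(1)[OF assms] clifford_adjoint[OF assms]
    by (simp add: clifford_def[of "Suc m"])
qed

text \<open>A one-qubit gate that satisfies this condition together with its adjoint normalizes the Pauli group
when placed on a qubit; only the action on the four basis matrices has to be checked.\<close>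
definition local_clifford :: "complex mat set" where
  "local_clifford = {A \<in> unitary 2. \<forall>\<sigma>\<in>pauli_basis. \<exists>k. k ^ 4 = 1 \<and>
     (\<exists>\<rho>\<in>pauli_basis. conj_by A \<sigma> = k \<cdot>\<^sub>m \<rho>)}"

lemma clifford_first_qubit:
  assumes "A \<in> local_clifford" "A\<^sup>\<dagger> \<in> local_clifford"
  shows "A \<otimes>\<^sub>k 1\<^sub>m (2 ^ m) \<in> clifford (Suc m)"
proof -
  have "conj_by (B \<otimes>\<^sub>k 1\<^sub>m (2 ^ m)) P \<in> pauli (Suc m)"
    if B: "B \<in> local_clifford" and P: "P \<in> pauli (Suc m)" for B P
    using P
  proof (rule pauli_SucE)
    fix \<sigma> Q assume *: "\<sigma> \<in> pauli_basis" "Q \<in> pauli m" "P = \<sigma> \<otimes>\<^sub>k Q"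
    obtain k \<rho> where k: "k ^ 4 = 1" "\<rho> \<in> pauli_basis" "conj_by B \<sigma> = k \<cdot>\<^sub>m \<rho>"
      using B *(1) by (auto simp: local_clifford_def)
    have "conj_by (B \<otimes>\<^sub>k 1\<^sub>m (2 ^ m)) P = conj_by B \<sigma> \<otimes>\<^sub>k Q"
      using B pauli_basis_carrier[OF *(1)] pauli_carrier[OF *(2)]
      by (simp add: *(3) local_clifford_def conj_by_kron[of _ _ "2 ^ m"])
    with k pauli_SucI_smult[OF k(2) *(2) k(1)] show ?thesis by simp
  qed
  moreover have "(A \<otimes>\<^sub>k 1\<^sub>m (2 ^ m))\<^sup>\<dagger> = A\<^sup>\<dagger> \<otimes>\<^sub>k 1\<^sub>m (2 ^ m)"
    using assms(1) by (simp add: local_clifford_def kron_adjoint[of _ _ "2 ^ m"])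
  moreover have "A \<otimes>\<^sub>k 1\<^sub>m (2 ^ m) \<in> unitary (2 ^ Suc m)"
    using assms(1) by (simp add: local_clifford_def)
  ultimately show ?thesis using assms by (simp add: clifford_def[of "Suc m"])
qed

text \<open>The controlled gate \<open>C = diag(1, R)\<close> sends \<open>diag(Q, s Q)\<close> to \<open>diag(Q, s R Q R)\<close> and the
antidiagonal matrix with blocks \<open>s Q\<close>, \<open>Q\<close> to the one with blocks \<open>s Q R\<close>, \<open>R Q\<close>. As \<open>R\<close> and
\<open>Q\<close> commute up to sign and \<open>R\<close> is an involution, the two blocks still agree up to sign.\<close>
lemma clifford_controlled:
  assumes R: "R \<in> pauli m" "R * R = 1\<^sub>m (2 ^ m)"
  shows "block_diag (1\<^sub>m (2 ^ m)) R \<in> clifford (Suc m)"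
proof -
  let ?d = "2 ^ m :: nat"
  note c = pauli_carrier[OF R(1)]
  \<comment> \<open>A unitary involution is its own adjoint, so the controlled gate is its own adjoint as well.\<close>
  have "R\<^sup>\<dagger> = R\<^sup>\<dagger> * (R * R)" using c R(2) by simp
  also have "\<dots> = R" using unitary_cancel(2)[OF pauli_unitary[OF R(1)] c] .
  finally have adj: "R\<^sup>\<dagger> = R" .
  have U: "block_diag (1\<^sub>m ?d) R \<in> unitary (2 ^ Suc m)"
    using c pauli_unitary[OF R(1)] by (simp add: block_unitary_iff)
  have adjoint: "(block_diag (1\<^sub>m ?d) R)\<^sup>\<dagger> = block_diag (1\<^sub>m ?d) R"
    using c by (simp add: block_adjoint[of _ ?d] adj)
  have "conj_by (block_diag (1\<^sub>m ?d) R) P \<in> pauli (Suc m)" if "P \<in> pauli (Suc m)" for P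
    using that
  proof (cases rule: pauli_Suc_block)
    case (1 Q s)
    note q = pauli_carrier[OF 1(1)]
    obtain k where k: "k \<in> {1, -1}" "R * Q = k \<cdot>\<^sub>m (Q * R)"
      using pauli_commute[OF R(1) 1(1)] by blast
    have "R * (s \<cdot>\<^sub>m Q) * R = (s * k) \<cdot>\<^sub>m (Q * R * R)"
      using c q by (simp add: mult_smult_distrib[of _ ?d ?d _ ?d] mult_smult_assoc_mat[of _ ?d ?d _ ?d]
          mult_carrier_mat[of _ ?d ?d _ ?d] k(2))
    also have "Q * R * R = Q"
      using c q R(2) by (simp add: assoc_mult_mat[of _ ?d ?d _ ?d _ ?d])
    finally have "conj_by (block_diag (1\<^sub>m ?d) R) P = block_diag Q ((s * k) \<cdot>\<^sub>m Q)"
      using c q by (simp add: conj_by_def adjoint 1 block_mult[of _ ?d] mult_carrier_mat[of _ ?d ?d _ ?d])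
    moreover have "s * k \<in> {1, -1}" using k 1 by auto
    ultimately show ?thesis using pauli_Suc_blockI(1)[OF 1(1)] by simp
  next
    case (2 Q s)
    note q = pauli_carrier[OF 2(1)]
    obtain k where k: "k \<in> {1, -1}" "R * Q = k \<cdot>\<^sub>m (Q * R)"
      using pauli_commute[OF R(1) 2(1)] by blast
    have "conj_by (block_diag (1\<^sub>m ?d) R) P = block_anti (s \<cdot>\<^sub>m (Q * R)) (R * Q)"
      using c q by (simp add: conj_by_def adjoint 2 block_mult[of _ ?d] mult_carrier_mat[of _ ?d ?d _ ?d]
          mult_smult_assoc_mat[of _ ?d ?d _ ?d])
    also have "s \<cdot>\<^sub>m (Q * R) = (s * k) \<cdot>\<^sub>m (R * Q)"
      using k by auto
    finally have "conj_by (block_diag (1\<^sub>m ?d) R) P = block_anti ((s * k) \<cdot>\<^sub>m (R * Q)) (R * Q)" .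
    moreover have "s * k \<in> {1, -1}" using k 2 by auto
    ultimately show ?thesis using pauli_Suc_blockI(2)[OF pauli_mult[OF R(1) 2(1)]] by simp
  qed
  with U adjoint show ?thesis by (simp add: clifford_def[of "Suc m"])
qed

section \<open>Gates on a register of qubits\<close>

lemma gate_mat2:
  "X_gate = mat2 0 1 1 0" "Z_gate = mat2 1 0 0 (-1)" "S_gate \<omega> = mat2 1 0 0 (\<omega>\<^sup>2)"
  "H_gate = mat2 (1 / sqrt 2) (1 / sqrt 2) (1 / sqrt 2) (- (1 / sqrt 2))"
  by (simp_all add: X_gate_def Z_gate_def S_gate_def H_gate_def mat2_def[symmetric] mat2_smult)

lemma gate_carrier [simp]:
  "X_gate \<in> carrier_mat 2 2" "Z_gate \<in> carrier_mat 2 2" "S_gate \<omega> \<in> carrier_mat 2 2"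
  "H_gate \<in> carrier_mat 2 2"
  by (simp_all add: gate_mat2)

lemma on_qubit_first: "on_qubit (Suc m) 1 A = A \<otimes>\<^sub>k 1\<^sub>m (2 ^ m)"
  by (simp add: on_qubit_def kron_pow_one kron_one_left[simplified])

lemma kron_pow_one_Suc: "kron_pow (1\<^sub>m 2) (Suc k) = 1\<^sub>m 2 \<otimes>\<^sub>k kron_pow (1\<^sub>m 2) k"
  unfolding kron_pow_one kron_one_one by simp

text \<open>The recursion behind all inductions on the number of qubits: qubit \<open>i + 1\<close> of \<open>m + 1\<close> is
qubit \<open>i\<close> after an idle first qubit. The bound \<open>i \<ge> 1\<close> is needed as \<open>i - 1\<close> is truncated at \<open>0\<close>.\<close>
lemma on_qubit_Suc:
  assumes "i \<ge> 1"
  shows "on_qubit (Suc m) (Suc i) A = 1\<^sub>m 2 \<otimes>\<^sub>k on_qubit m i A"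
    "on_qubit_pair (Suc m) (Suc i) A = 1\<^sub>m 2 \<otimes>\<^sub>k on_qubit_pair m i A"
proof -
  obtain j where i: "i = Suc j" using assms by (cases i) auto
  show "on_qubit (Suc m) (Suc i) A = 1\<^sub>m 2 \<otimes>\<^sub>k on_qubit m i A"
    "on_qubit_pair (Suc m) (Suc i) A = 1\<^sub>m 2 \<otimes>\<^sub>k on_qubit_pair m i A"
    by (simp_all add: on_qubit_def on_qubit_pair_def i kron_pow_one_Suc kron_assoc del: kron_pow.simps)
qed

text \<open>For an index below \<open>a * e\<close> the quotient by \<open>e\<close> is below \<open>a\<close>; otherwise both the quotient and the
index are shifted into the second block without changing the remainder.\<close>
lemma kron_block_diag:
  assumes A: "A \<in> carrier_mat a a" and D: "D \<in> carrier_mat a a" and E: "E \<in> carrier_mat e e"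
  shows "block_diag A D \<otimes>\<^sub>k E = block_diag (A \<otimes>\<^sub>k E) (D \<otimes>\<^sub>k E)"
proof (rule eq_matI)
  have AE: "A \<otimes>\<^sub>k E \<in> carrier_mat (a * e) (a * e)" "D \<otimes>\<^sub>k E \<in> carrier_mat (a * e) (a * e)"
    using assms by auto
  fix i j assume "i < dim_row (block_diag (A \<otimes>\<^sub>k E) (D \<otimes>\<^sub>k E))"
    "j < dim_col (block_diag (A \<otimes>\<^sub>k E) (D \<otimes>\<^sub>k E))"
  then have ij: "i < 2 * a * e" "j < 2 * a * e"
    using A D E by (auto simp: block_diag_def mult_2 distrib_right)
  then have e: "e > 0" by (auto intro: gr0I)
  have digit: "r div e < a \<longleftrightarrow> r < a * e" "\<not> r < a * e \<Longrightarrow> r div e - a = (r - a * e) div e"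
    "\<not> r < a * e \<Longrightarrow> r mod e = (r - a * e) mod e" "r < 2 * a * e \<Longrightarrow> r div e < a + a" for r
  proof -
    show "r div e < a \<longleftrightarrow> r < a * e" using e by (rule div_less_iff_less_mult)
    have shift: "\<exists>q. r = a * e + q" if "\<not> r < a * e"
      using that by (metis le_Suc_ex linorder_not_less)
    show "r div e - a = (r - a * e) div e" if "\<not> r < a * e"
      using shift[OF that] e by (auto simp: add.commute)
    show "r mod e = (r - a * e) mod e" if "\<not> r < a * e"
      using shift[OF that] by auto
    show "r < 2 * a * e \<Longrightarrow> r div e < a + a"
      using e by (simp add: div_less_iff_less_mult mult_2 distrib_right)
  qed
  show "(block_diag A D \<otimes>\<^sub>k E) $$ (i, j) = block_diag (A \<otimes>\<^sub>k E) (D \<otimes>\<^sub>k E) $$ (i, j)"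
    unfolding block_four_block(1)[OF A D] block_four_block(1)[OF AE]
    using A D E AE ij e digit(4)[OF ij(1)] digit(4)[OF ij(2)]
    by (cases "i < a * e"; cases "j < a * e")
      (simp_all add: kron_index digit(1-3) less_diff_conv2 mult_2 distrib_right)
qed (use A D E in \<open>auto simp: block_diag_def distrib_right\<close>)

text \<open>The controlled sign gate applies \<open>Z\<close> to the second qubit exactly when the first one is set.\<close>
lemma CZ_block: "CZ_gate = block_diag (1\<^sub>m 2) Z_gate"
proof (rule eq_matI)
  fix i j assume "i < dim_row (block_diag (1\<^sub>m 2) Z_gate)" "j < dim_col (block_diag (1\<^sub>m 2) Z_gate)"
  then have "i \<in> {0, 1, 2, 3}" "j \<in> {0, 1, 2, 3}"
    by (auto simp: block_diag_def gate_mat2)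
  then show "CZ_gate $$ (i, j) = block_diag (1\<^sub>m 2) Z_gate $$ (i, j)"
    unfolding block_four_block(1)[OF one_carrier_mat gate_carrier(2)]
    by (auto simp: CZ_gate_def gate_mat2 mat_of_rows_list_def numeral_2_eq_2 numeral_3_eq_3)
qed (auto simp: block_diag_def gate_mat2 CZ_gate_def mat_of_rows_list_def)

lemma on_qubit_pair_first:
  "on_qubit_pair (Suc (Suc k)) 1 CZ_gate = block_diag (1\<^sub>m (2 ^ Suc k)) (Z_gate \<otimes>\<^sub>k 1\<^sub>m (2 ^ k))"
  unfolding on_qubit_pair_def CZ_block
  by (simp add: kron_pow_one kron_one_left[simplified] kron_block_diag[of _ 2 _ _ "2 ^ k"] kron_one_one)

lemma unit_scalars_unitary: "unit_scalars n \<subseteq> unitary (2 ^ n)"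
  by (auto simp: unit_scalars_def)

section \<open>The gates H, S, CZ and the circuits built from them\<close>

text \<open>Only the square of \<open>\<omega>\<close> enters the gates. It is a square root of \<open>-1\<close>, and either of the two
square roots may occur.\<close>
locale eighth_root =
  fixes \<omega> :: complex
  assumes primitive: "primitive_unity_root 8 \<omega>"
begin

abbreviation w :: complex where "w \<equiv> \<omega>\<^sup>2"

text \<open>The square of \<open>\<omega> ^ 4\<close> is \<open>1\<close> while \<open>\<omega> ^ 4\<close> itself is not.\<close>
lemma w_square: "w * w = -1"
proof -
  have "\<omega> ^ 8 = 1" "\<omega> ^ 4 \<noteq> 1"
    using primitive by (auto simp: primitive_unity_root_def)
  moreover have "(\<omega> ^ 4)\<^sup>2 = \<omega> ^ 8" by (simp flip: power_mult)
  ultimately have "\<omega> ^ 4 = -1" by (metis power2_eq_1_iff)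
  then show ?thesis by (simp add: power2_eq_square power4_eq_xxxx mult.assoc)
qed

lemma w_phase: "w ^ 4 = 1"
proof -
  have "w ^ 4 = (w * w) * (w * w)" by (simp only: power4_eq_xxxx[of w] mult.assoc)
  then show ?thesis by (simp only: w_square) simp
qed

lemma w_cnj: "w * cnj w = 1" "cnj w * w = 1" "cnj w = - w"
proof -
  show "w * cnj w = 1" using phase_cmod[OF w_phase] cmod_one_iff by blast
  then show "cnj w * w = 1" by (simp only: mult.commute)
  have "cnj w = - (w * w) * cnj w" using w_square by simp
  also have "\<dots> = - w * (w * cnj w)" by (simp only: mult.assoc mult_minus_left)
  also have "\<dots> = - w" by (simp only: \<open>w * cnj w = 1\<close>) simp
  finally show "cnj w = - w" .
qed

lemma phase_cases:
  assumes "c ^ 4 = 1"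
  shows "c \<in> {1, -1, w, -w}"
proof -
  have "(c\<^sup>2)\<^sup>2 = 1" using assms by (simp flip: power_mult)
  then have "c\<^sup>2 = 1 \<or> c\<^sup>2 = w\<^sup>2"
    unfolding power2_eq_1_iff using w_square by (simp only: power2_eq_square)
  then show ?thesis by (auto simp only: power2_eq_1_iff power2_eq_iff)
qed

lemma H_local: "H_gate \<in> local_clifford" "H_gate\<^sup>\<dagger> = H_gate"
    "conj_by H_gate X_gate = Z_gate" "conj_by H_gate Z_gate = X_gate"
proof -
  define r :: complex where "r = 1 / complex_of_real (sqrt 2)"
  have r: "cnj r = r" "r * r = 1 / 2"
    by (simp_all add: r_def flip: of_real_mult)
  have r': "r * (r * x) = x / 2" for x
    using r(2) by (simp flip: mult.assoc)
  have H: "H_gate = mat2 r r r (- r)"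
    by (simp add: gate_mat2 r_def)
  show "H_gate\<^sup>\<dagger> = H_gate"
    by (simp add: H mat2_simps r)
  show "conj_by H_gate X_gate = Z_gate" "conj_by H_gate Z_gate = X_gate"
    by (simp_all add: conj_by_def H gate_mat2(1,2) mat2_simps r r')
  have "\<exists>k. k ^ 4 = 1 \<and> (\<exists>\<rho>\<in>pauli_basis. conj_by H_gate \<sigma> = k \<cdot>\<^sub>m \<rho>)" if "\<sigma> \<in> pauli_basis" for \<sigma>
  proof -
    consider "\<sigma> = mat2 1 0 0 1" | "\<sigma> = mat2 1 0 0 (-1)" | "\<sigma> = mat2 0 1 1 0" | "\<sigma> = mat2 0 (-1) 1 0"
      using \<open>\<sigma> \<in> pauli_basis\<close> by (auto simp: pauli_basis_def)
    then have "\<exists>k\<in>{1, -1}. \<exists>\<rho>\<in>pauli_basis. conj_by H_gate \<sigma> = k \<cdot>\<^sub>m \<rho>"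
      by cases (simp_all add: conj_by_def H mat2_simps r r' pauli_basis_def)
    then show ?thesis using sign_phase by blast
  qed
  moreover have "H_gate \<in> unitary 2"
    by (rule unitaryI) (simp_all add: H mat2_simps r r')
  ultimately show "H_gate \<in> local_clifford"
    by (simp add: local_clifford_def)
qed

text \<open>Conjugation by \<open>S\<close> or by its adjoint fixes the diagonal basis matrices and exchanges \<open>X\<close> and \<open>X Z\<close>
up to a phase.\<close>
lemma S_local: "S_gate \<omega> \<in> local_clifford" "(S_gate \<omega>)\<^sup>\<dagger> \<in> local_clifford"
    "conj_by (S_gate \<omega>) (mat2 0 (-1) 1 0) = w \<cdot>\<^sub>m X_gate"
    "S_gate \<omega> * S_gate \<omega> = Z_gate"
    "conj_by (S_gate \<omega>) X_gate = w \<cdot>\<^sub>m mat2 0 (-1) 1 0"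
proof -
  have S: "S_gate \<omega> = mat2 1 0 0 w" by (simp only: gate_mat2)
  have adj: "(mat2 1 0 0 w)\<^sup>\<dagger> = mat2 1 0 0 (- w)"
    using w_cnj(3) by (simp only: mat2_adjoint complex_cnj_one complex_cnj_zero)
  have adj': "(mat2 1 0 0 (- w))\<^sup>\<dagger> = mat2 1 0 0 w"
    using w_cnj(3) by (simp only: mat2_adjoint complex_cnj_one complex_cnj_zero complex_cnj_minus minus_minus)
  have phases: "(- w) ^ 4 = 1" using w_phase by simp
  have conj: "conj_by (mat2 1 0 0 w) (mat2 1 0 0 s) = mat2 1 0 0 s"
    "conj_by (mat2 1 0 0 (- w)) (mat2 1 0 0 s) = mat2 1 0 0 s"
    "conj_by (mat2 1 0 0 w) (mat2 0 s 1 0) = w \<cdot>\<^sub>m mat2 0 (- s) 1 0"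
    "conj_by (mat2 1 0 0 (- w)) (mat2 0 s 1 0) = (- w) \<cdot>\<^sub>m mat2 0 (- s) 1 0" for s
  proof -
    obtain v where v: "w = v" "v * v = -1" using w_square by blast
    have vv: "v * (x * v) = - x" for x
      using v(2) by (metis mult.left_commute mult_minus1_right)
    show "conj_by (mat2 1 0 0 w) (mat2 1 0 0 s) = mat2 1 0 0 s"
      "conj_by (mat2 1 0 0 (- w)) (mat2 1 0 0 s) = mat2 1 0 0 s"
      "conj_by (mat2 1 0 0 w) (mat2 0 s 1 0) = w \<cdot>\<^sub>m mat2 0 (- s) 1 0"
      "conj_by (mat2 1 0 0 (- w)) (mat2 0 s 1 0) = (- w) \<cdot>\<^sub>m mat2 0 (- s) 1 0"
      unfolding conj_by_def v(1) adj[unfolded v(1)] adj'[unfolded v(1)]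
      by (simp_all add: mat2_mult mat2_smult mat2_eq_iff vv mult.assoc)
  qed
  have basis: "\<exists>k. k ^ 4 = 1 \<and> (\<exists>\<rho>\<in>pauli_basis. conj_by (mat2 1 0 0 v) \<sigma> = k \<cdot>\<^sub>m \<rho>)"
    if "\<sigma> \<in> pauli_basis" "v \<in> {w, -w}" for \<sigma> v
  proof -
    obtain s where s: "s \<in> {1, -1}" "\<sigma> = mat2 1 0 0 s \<or> \<sigma> = mat2 0 s 1 0"
      using \<open>\<sigma> \<in> pauli_basis\<close> by (auto simp: pauli_basis_def)
    have in_basis: "mat2 1 0 0 s \<in> pauli_basis" "mat2 0 (- s) 1 0 \<in> pauli_basis"
      using s(1) by (auto simp: pauli_basis_def)
    from s(2) show ?thesis
    proof
      assume "\<sigma> = mat2 1 0 0 s"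
      then show ?thesis
        using that(2) conj in_basis(1) by (intro exI[of _ 1]) (auto intro!: bexI[of _ "mat2 1 0 0 s"])
    next
      assume "\<sigma> = mat2 0 s 1 0"
      then show ?thesis
        using that(2) conj in_basis(2) phases w_phase by (intro exI[of _ v]) auto
    qed
  qed
  have U: "mat2 1 0 0 w \<in> unitary 2"
    using w_cnj by (simp add: unitary_iff mat2_simps)
  show "S_gate \<omega> \<in> local_clifford"
    unfolding S local_clifford_def using U basis by blast
  show "(S_gate \<omega>)\<^sup>\<dagger> \<in> local_clifford"
    unfolding S local_clifford_def using unitary_adjoint[OF U] basis unfolding adj by blast
  show "conj_by (S_gate \<omega>) (mat2 0 (-1) 1 0) = w \<cdot>\<^sub>m X_gate"
    "conj_by (S_gate \<omega>) X_gate = w \<cdot>\<^sub>m mat2 0 (-1) 1 0"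
    unfolding S gate_mat2(1) conj by simp_all
  show "S_gate \<omega> * S_gate \<omega> = Z_gate"
    unfolding S gate_mat2(2) mat2_simps using w_square by simp
qed

lemma gate_unitary [simp]:
  "H_gate \<in> unitary 2" "S_gate \<omega> \<in> unitary 2"
  using H_local(1) S_local(1) by (auto simp: local_clifford_def)

lemma Z_X_pauli: "X_gate \<in> pauli_basis" "Z_gate \<in> pauli_basis"
  by (simp_all add: gate_mat2 pauli_basis_def)

text \<open>The parameters are the first qubits on which \<open>H\<close> and \<open>S\<close> are available; \<open>CZ\<close> is available on all
neighbouring pairs. The full gate set is \<open>gate_set n 1 1\<close>, the generating set for the centralizer is
\<open>gate_set n 2 1\<close>, and \<open>gate_set n 2 2\<close> is the one without \<open>S\<close> on qubit 1.\<close>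
definition gate_set :: "nat \<Rightarrow> nat \<Rightarrow> nat \<Rightarrow> complex mat set" where
  "gate_set n a b = {on_qubit n i H_gate | i. i \<in> {a..n}} \<union> {on_qubit n i (S_gate \<omega>) | i. i \<in> {b..n}}
     \<union> {on_qubit_pair n i CZ_gate | i. i \<in> {1..n - 1}}"

text \<open>Circuits with all global phases. Including the scalars makes equality up to phase harmless until
the passage to projective classes.\<close>
definition circuits :: "nat \<Rightarrow> nat \<Rightarrow> nat \<Rightarrow> complex mat set" where
  "circuits n a b = generate (unitary_group (2 ^ n)) (gate_set n a b \<union> unit_scalars n)"

lemma Z_first: "Z_gate \<otimes>\<^sub>k 1\<^sub>m (2 ^ k) \<in> pauli (Suc k)"
    "(Z_gate \<otimes>\<^sub>k 1\<^sub>m (2 ^ k)) * (Z_gate \<otimes>\<^sub>k 1\<^sub>m (2 ^ k)) = 1\<^sub>m (2 ^ Suc k)"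
    "(Z_gate \<otimes>\<^sub>k 1\<^sub>m (2 ^ k)) \<in> carrier_mat (2 ^ Suc k) (2 ^ Suc k)"
proof -
  show "Z_gate \<otimes>\<^sub>k 1\<^sub>m (2 ^ k) \<in> pauli (Suc k)"
    using pauli_SucI[OF Z_X_pauli(2) pauli_one] .
  have "Z_gate * Z_gate = 1\<^sub>m 2" by (simp add: gate_mat2 mat2_simps)
  then show "(Z_gate \<otimes>\<^sub>k 1\<^sub>m (2 ^ k)) * (Z_gate \<otimes>\<^sub>k 1\<^sub>m (2 ^ k)) = 1\<^sub>m (2 ^ Suc k)"
    by (simp add: kron_mult[of _ _ _ "2 ^ k"] kron_one_one)
  show "(Z_gate \<otimes>\<^sub>k 1\<^sub>m (2 ^ k)) \<in> carrier_mat (2 ^ Suc k) (2 ^ Suc k)"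
    using kron_carrier2[OF gate_carrier(2) one_carrier_mat] by simp
qed

lemma on_qubit_clifford:
  assumes "A \<in> local_clifford" "A\<^sup>\<dagger> \<in> local_clifford" "i \<in> {1..n}"
  shows "on_qubit n i A \<in> clifford n"
  using assms(3)
proof (induction n arbitrary: i)
  case (Suc n)
  show ?case
  proof (cases "i = 1")
    case True
    then show ?thesis using clifford_first_qubit[OF assms(1,2)] by (simp only: on_qubit_first)
  next
    case False
    with Suc.prems obtain j where "i = Suc j" "j \<in> {1..n}" by (cases i) auto
    then show ?thesis using clifford_lift[OF Suc.IH] by (simp add: on_qubit_Suc)
  qed
qed simp

lemma on_qubit_pair_clifford:
  assumes "i \<in> {1..n - 1}"
  shows "on_qubit_pair n i CZ_gate \<in> clifford n"
  using assms
proof (induction n arbitrary: i)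
  case (Suc n)
  then obtain k where k: "n = Suc k" by (cases n) auto
  show ?case
  proof (cases "i = 1")
    case True
    then show ?thesis
      using clifford_controlled[OF Z_first(1,2)[of k]] by (simp only: k on_qubit_pair_first)
  next
    case False
    with Suc.prems obtain j where "i = Suc j" "j \<in> {1..n - 1}" by (cases i) auto
    then show ?thesis using clifford_lift[OF Suc.IH] by (simp add: on_qubit_Suc)
  qed
qed simp

lemma gate_set_clifford:
  assumes "a \<ge> 1" "b \<ge> 1"
  shows "gate_set n a b \<subseteq> clifford n"
proof -
  have "on_qubit n i H_gate \<in> clifford n" if "i \<in> {1..n}" for i
    using on_qubit_clifford[OF H_local(1) _ that] H_local(1) by (simp only: H_local(2))
  then show ?thesis
    using assms on_qubit_clifford[OF S_local(1,2)] on_qubit_pair_clifford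
    by (auto simp: gate_set_def)
qed

lemma generators_unitary:
  assumes "a \<ge> 1" "b \<ge> 1"
  shows "gate_set n a b \<union> unit_scalars n \<subseteq> unitary (2 ^ n)"
  using gate_set_clifford[OF assms] cliffordD(1) unit_scalars_unitary by blast

lemma circuits_clifford:
  assumes "a \<ge> 1" "b \<ge> 1"
  shows "circuits n a b \<subseteq> clifford n"
  unfolding circuits_def
  using gate_set_clifford[OF assms] clifford_scalar
  by (intro unitary_group.generate_subgroup_incl clifford_subgroup) (auto simp: unit_scalars_def)

lemma circuits_mono:
  assumes "a' \<le> a" "b' \<le> b"
  shows "circuits n a b \<subseteq> circuits n a' b'"
  unfolding circuits_def using assms
  by (intro unitary_group.mono_generate) (fastforce simp: gate_set_def)

lemma gate_set_circuits: "g \<in> gate_set n a b \<Longrightarrow> g \<in> circuits n a b"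
  unfolding circuits_def by (rule generate.incl) simp

lemma circuits_gates:
  "i \<in> {a..n} \<Longrightarrow> on_qubit n i H_gate \<in> circuits n a b"
  "i \<in> {b..n} \<Longrightarrow> on_qubit n i (S_gate \<omega>) \<in> circuits n a b"
  "i \<in> {1..n - 1} \<Longrightarrow> on_qubit_pair n i CZ_gate \<in> circuits n a b"
  by (auto intro!: gate_set_circuits simp: gate_set_def)

lemma unit_scalars_circuits: "unit_scalars n \<subseteq> circuits n a b"
  unfolding circuits_def by (auto intro: generate.incl)

lemma circuits_scalar: "cmod c = 1 \<Longrightarrow> c \<cdot>\<^sub>m 1\<^sub>m (2 ^ n) \<in> circuits n a b"
  using unit_scalars_circuits by (fastforce simp: unit_scalars_def)

lemma circuits_one: "1\<^sub>m (2 ^ n) \<in> circuits n a b"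
  using circuits_scalar[of 1 n] by simp

lemma circuits_mult: "V \<in> circuits n a b \<Longrightarrow> W \<in> circuits n a b \<Longrightarrow> V * W \<in> circuits n a b"
  unfolding circuits_def using generate.eng by fastforce

lemma circuits_unitary:
  assumes "a \<ge> 1" "b \<ge> 1" "V \<in> circuits n a b"
  shows "V \<in> unitary (2 ^ n)"
  using circuits_clifford[OF assms(1,2)] assms(3) cliffordD(1) by blast

lemma circuits_adjoint:
  assumes "a \<ge> 1" "b \<ge> 1" "V \<in> circuits n a b"
  shows "V\<^sup>\<dagger> \<in> circuits n a b"
  using unitary_group.generate_m_inv_closed[OF generators_unitary[OF assms(1,2)]
      assms(3)[unfolded circuits_def]]
  unfolding unitary_inv[OF circuits_unitary[OF assms]] circuits_def .

lemma gate_set_lift: "(\<otimes>\<^sub>k) (1\<^sub>m 2) ` gate_set m 1 1 \<subseteq> gate_set (Suc m) 2 2"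
proof
  fix g assume "g \<in> (\<otimes>\<^sub>k) (1\<^sub>m 2) ` gate_set m 1 1"
  then obtain h where g: "g = 1\<^sub>m 2 \<otimes>\<^sub>k h" and "h \<in> gate_set m 1 1" by blast
  then consider i where "i \<in> {1..m}" "h = on_qubit m i H_gate"
    | i where "i \<in> {1..m}" "h = on_qubit m i (S_gate \<omega>)"
    | i where "i \<in> {1..m - 1}" "h = on_qubit_pair m i CZ_gate"
    unfolding gate_set_def by blast
  then show "g \<in> gate_set (Suc m) 2 2"
  proof cases
    case 1
    then have "g = on_qubit (Suc m) (Suc i) H_gate" "Suc i \<in> {2..Suc m}"
      by (simp_all add: g on_qubit_Suc)
    then show ?thesis unfolding gate_set_def by blast
  next
    case 2
    then have "g = on_qubit (Suc m) (Suc i) (S_gate \<omega>)" "Suc i \<in> {2..Suc m}"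
      by (simp_all add: g on_qubit_Suc)
    then show ?thesis unfolding gate_set_def by blast
  next
    case 3
    then have "g = on_qubit_pair (Suc m) (Suc i) CZ_gate" "Suc i \<in> {1..Suc m - 1}"
      by (auto simp: g on_qubit_Suc)
    then show ?thesis unfolding gate_set_def by blast
  qed
qed

text \<open>A circuit can be moved to the qubits after the first one, where it uses no one-qubit gate on
qubit 1.\<close>
lemma circuits_lift:
  assumes "A \<in> circuits m 1 1"
  shows "1\<^sub>m 2 \<otimes>\<^sub>k A \<in> circuits (Suc m) 2 2"
proof -
  interpret lift: group_hom "unitary_group (2 ^ m)" "unitary_group (2 * 2 ^ m)" "(\<otimes>\<^sub>k) (1\<^sub>m 2)"
    by (rule lift_group_hom)
  have "1\<^sub>m 2 \<otimes>\<^sub>k (c \<cdot>\<^sub>m 1\<^sub>m (2 ^ m)) = c \<cdot>\<^sub>m 1\<^sub>m (2 ^ Suc m)" for c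
    by (simp add: kron_smult_right kron_one_one)
  then have "(\<otimes>\<^sub>k) (1\<^sub>m 2) ` unit_scalars m \<subseteq> unit_scalars (Suc m)"
    unfolding unit_scalars_def by blast
  with gate_set_lift have
    "(\<otimes>\<^sub>k) (1\<^sub>m 2) ` (gate_set m 1 1 \<union> unit_scalars m) \<subseteq> gate_set (Suc m) 2 2 \<union> unit_scalars (Suc m)"
    by blast
  from unitary_group.mono_generate[OF this, of "2 * 2 ^ m"] show ?thesis
    using assms lift.generate_img[OF generators_unitary[of 1 1 m]] by (auto simp: circuits_def)
qed

end

section \<open>Matrices commuting with a diagonal gate on the first qubit\<close>

text \<open>With blocks \<open>A, B, C, D\<close> the hypothesis says \<open>A = c A\<close>, \<open>a B = c B\<close>, \<open>C = c a C\<close> and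
\<open>a D = c a D\<close>. If \<open>c = 1\<close> the off-diagonal blocks vanish because \<open>a \<noteq> 1\<close>. Otherwise the diagonal
blocks vanish, the other two are unitary, and they force \<open>a = c\<close> and \<open>c a = 1\<close>.\<close>
lemma commute_first_qubit_cases:
  assumes U: "U \<in> unitary (2 * d)" and d: "d > 0" and a: "a \<noteq> 1" "a \<noteq> 0"
    and comm: "U * (mat2 1 0 0 a \<otimes>\<^sub>k 1\<^sub>m d) = c \<cdot>\<^sub>m ((mat2 1 0 0 a \<otimes>\<^sub>k 1\<^sub>m d) * U)"
  obtains A D where "A \<in> unitary d" "D \<in> unitary d" "U = block_diag A D"
  | B C where "B \<in> unitary d" "C \<in> unitary d" "U = block_anti B C" "a * a = 1"
proof -
  obtain A B C D where blocks: "A \<in> carrier_mat d d" "B \<in> carrier_mat d d" "C \<in> carrier_mat d d"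
    "D \<in> carrier_mat d d" and U_eq: "U = four_block_mat A B C D"
    using four_block_mat_cases[of U d] U by blast
  have gate: "mat2 1 0 0 a \<otimes>\<^sub>k 1\<^sub>m d = four_block_mat (1\<^sub>m d) (0\<^sub>m d d) (0\<^sub>m d d) (a \<cdot>\<^sub>m 1\<^sub>m d)"
    by (simp add: kron_mat2[of _ d] zero_smult_mat[of _ d d])
  have left: "U * (mat2 1 0 0 a \<otimes>\<^sub>k 1\<^sub>m d) = four_block_mat A (a \<cdot>\<^sub>m B) C (a \<cdot>\<^sub>m D)"
    unfolding U_eq gate using blocks
    by (simp add: mult_four_block_mat[of _ d d _ d _ d _ _ d _ d] mult_smult_distrib[of _ d d _ d])
  have right: "(mat2 1 0 0 a \<otimes>\<^sub>k 1\<^sub>m d) * U = four_block_mat A B (a \<cdot>\<^sub>m C) (a \<cdot>\<^sub>m D)"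
    unfolding U_eq gate using blocks
    by (simp add: mult_four_block_mat[of _ d d _ d _ d _ _ d _ d] mult_smult_assoc_mat[of _ d d _ d])
  have eqs: "1 \<cdot>\<^sub>m A = c \<cdot>\<^sub>m A" "a \<cdot>\<^sub>m B = c \<cdot>\<^sub>m B" "1 \<cdot>\<^sub>m C = (c * a) \<cdot>\<^sub>m C"
      "a \<cdot>\<^sub>m D = (c * a) \<cdot>\<^sub>m D"
    using comm blocks unfolding left right
    by (simp_all add: smult_four_block_mat[of _ d d _ d _ d] four_block_mat_inject[of _ d])
  show thesis
  proof (cases "c = 1")
    case True
    then have "B = 0\<^sub>m d d" "C = 0\<^sub>m d d"
      using smult_eq_zero[OF eqs(2), of d d] smult_eq_zero[OF eqs(3), of d d] blocks a by auto
    then have "U = block_diag A D"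
      using blocks by (simp add: U_eq block_four_block[of _ d])
    moreover from this have "A \<in> unitary d" "D \<in> unitary d"
      using U block_unitary_iff(1)[OF blocks(1,4)] by auto
    ultimately show thesis using that(1) by blast
  next
    case False
    then have "A = 0\<^sub>m d d" "D = 0\<^sub>m d d"
      using smult_eq_zero[OF eqs(1), of d d] smult_eq_zero[OF eqs(4), of d d] blocks a by auto
    then have U': "U = block_anti B C"
      using blocks by (simp add: U_eq block_four_block[of _ d])
    moreover from this have BC: "B \<in> unitary d" "C \<in> unitary d"
      using U block_unitary_iff(2)[OF blocks(2,3)] by auto
    moreover have "a = c" "1 = c * a"
      using smult_eq_unitary[OF eqs(2) BC(1) d] smult_eq_unitary[OF eqs(3) BC(2) d] by auto
    ultimately show thesis using that(2) by auto
  qed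
qed

context eighth_root
begin

section \<open>Reduction of Pauli matrices by circuits\<close>

text \<open>Reachability of one Pauli matrix from another by conjugation with circuits, ignoring phases.\<close>
definition reduces :: "nat \<Rightarrow> complex mat \<Rightarrow> complex mat \<Rightarrow> bool" where
  "reduces m P Q \<longleftrightarrow> (\<exists>G\<in>circuits m 1 1. \<exists>c. c ^ 4 = 1 \<and> conj_by G P = c \<cdot>\<^sub>m Q)"

lemma reducesI:
  "G \<in> circuits m 1 1 \<Longrightarrow> c ^ 4 = 1 \<Longrightarrow> conj_by G P = c \<cdot>\<^sub>m Q \<Longrightarrow> reduces m P Q"
  unfolding reduces_def by blast

lemma reduces_trans:
  assumes "reduces m P Q" "reduces m Q R"
    "P \<in> carrier_mat (2 ^ m) (2 ^ m)" "Q \<in> carrier_mat (2 ^ m) (2 ^ m)"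
  shows "reduces m P R"
proof -
  obtain G c where G: "G \<in> circuits m 1 1" "c ^ 4 = 1" "conj_by G P = c \<cdot>\<^sub>m Q"
    using assms(1) by (auto simp: reduces_def)
  obtain G' c' where G': "G' \<in> circuits m 1 1" "c' ^ 4 = 1" "conj_by G' Q = c' \<cdot>\<^sub>m R"
    using assms(2) by (auto simp: reduces_def)
  have "G \<in> unitary (2 ^ m)" "G' \<in> unitary (2 ^ m)"
    using G(1) G'(1) circuits_unitary[of 1 1] by auto
  then have "conj_by (G' * G) P = (c * c') \<cdot>\<^sub>m R"
    using assms(3,4) G(3) G'(3) by (simp add: conj_by_comp[of _ "2 ^ m"] conj_by_smult[of _ "2 ^ m"])
  moreover have "(c * c') ^ 4 = 1" using G(2) G'(2) by (simp add: power_mult_distrib)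
  ultimately show ?thesis using circuits_mult[OF G'(1) G(1)] by (auto intro: reducesI)
qed

lemma reduces_refl: "P \<in> carrier_mat (2 ^ m) (2 ^ m) \<Longrightarrow> reduces m P P"
  by (rule reducesI[OF circuits_one, of 1]) simp_all

lemma reduces_lift:
  assumes "reduces m P Q" "\<sigma> \<in> carrier_mat 2 2" "P \<in> carrier_mat (2 ^ m) (2 ^ m)"
  shows "reduces (Suc m) (\<sigma> \<otimes>\<^sub>k P) (\<sigma> \<otimes>\<^sub>k Q)"
proof -
  obtain G c where G: "G \<in> circuits m 1 1" "c ^ 4 = 1" "conj_by G P = c \<cdot>\<^sub>m Q"
    using assms(1) by (auto simp: reduces_def)
  have "G \<in> unitary (2 ^ m)" using circuits_unitary[OF _ _ G(1)] by simp
  then have "conj_by (1\<^sub>m 2 \<otimes>\<^sub>k G) (\<sigma> \<otimes>\<^sub>k P) = c \<cdot>\<^sub>m (\<sigma> \<otimes>\<^sub>k Q)"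
    using assms(2,3) G(3) by (simp add: conj_by_kron[of _ _ "2 ^ m"] kron_smult_right)
  moreover have "1\<^sub>m 2 \<otimes>\<^sub>k G \<in> circuits (Suc m) 1 1"
    using circuits_lift[OF G(1)] circuits_mono[of 1 2 1 2 "Suc m"] by auto
  ultimately show ?thesis using G(2) by (auto intro: reducesI)
qed

lemma circuits_first_qubit:
  "H_gate \<otimes>\<^sub>k 1\<^sub>m (2 ^ m) \<in> circuits (Suc m) 1 b" "S_gate \<omega> \<otimes>\<^sub>k 1\<^sub>m (2 ^ m) \<in> circuits (Suc m) a 1"
  "block_diag (1\<^sub>m (2 ^ Suc m)) (Z_gate \<otimes>\<^sub>k 1\<^sub>m (2 ^ m)) \<in> circuits (Suc (Suc m)) a b"
  using circuits_gates(1)[of 1 1 "Suc m" b] circuits_gates(2)[of 1 1 "Suc m" a]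
    circuits_gates(3)[of 1 "Suc (Suc m)" a b]
  by (simp_all only: on_qubit_first on_qubit_pair_first) simp_all

lemma reduces_first_qubit:
  assumes "A \<otimes>\<^sub>k 1\<^sub>m (2 ^ m) \<in> circuits (Suc m) 1 1" "A \<in> unitary 2" "conj_by A \<sigma> = c \<cdot>\<^sub>m \<tau>" "c ^ 4 = 1"
    "\<sigma> \<in> carrier_mat 2 2" "Q \<in> carrier_mat (2 ^ m) (2 ^ m)"
  shows "reduces (Suc m) (\<sigma> \<otimes>\<^sub>k Q) (\<tau> \<otimes>\<^sub>k Q)"
  using assms by (intro reducesI[OF assms(1,4)]) (simp add: conj_by_kron[of _ _ "2 ^ m"] kron_smult_left)

lemma reduces_Z_X:
  assumes "Q \<in> carrier_mat (2 ^ m) (2 ^ m)"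
  shows "reduces (Suc m) (Z_gate \<otimes>\<^sub>k Q) (X_gate \<otimes>\<^sub>k Q)" "reduces (Suc m) (X_gate \<otimes>\<^sub>k Q) (Z_gate \<otimes>\<^sub>k Q)"
  using reduces_first_qubit[OF circuits_first_qubit(1), where c = 1] assms
  by (simp_all add: H_local)

text \<open>On one qubit, \<open>H\<close> and \<open>S\<close> act transitively on the non-trivial Pauli matrices up to phase: \<open>H\<close>
takes \<open>Z\<close> to \<open>X\<close>, and \<open>S\<close> takes \<open>X Z\<close> to a multiple of \<open>X\<close>.\<close>
lemma reduces_X:
  assumes "\<sigma> \<in> pauli_basis" "\<sigma> \<noteq> 1\<^sub>m 2" and Q: "Q \<in> carrier_mat (2 ^ m) (2 ^ m)"
  shows "reduces (Suc m) (\<sigma> \<otimes>\<^sub>k Q) (X_gate \<otimes>\<^sub>k Q)"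
proof -
  consider "\<sigma> = Z_gate" | "\<sigma> = X_gate" | "\<sigma> = mat2 0 (-1) 1 0"
    using assms(1,2) by (auto simp: pauli_basis_def gate_mat2 mat2_one)
  then show ?thesis
  proof cases
    case 1
    then show ?thesis using reduces_Z_X(1)[OF Q] by simp
  next
    case 2
    then show ?thesis using reduces_refl[of "X_gate \<otimes>\<^sub>k Q" "Suc m"] Q by simp
  next
    case 3
    then show ?thesis
      using reduces_first_qubit[OF circuits_first_qubit(2) gate_unitary(2) S_local(3) w_phase _ Q]
      by simp
  qed
qed

text \<open>The two moves that only an entangling gate can make: \<open>CZ\<close> on the first two qubits clears the second
factor of \<open>X \<otimes> Z\<close>, and it creates a first factor in \<open>1 \<otimes> X\<close>.\<close>
lemma reduces_CZ:
  fixes k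
  defines "Z \<equiv> Z_gate \<otimes>\<^sub>k 1\<^sub>m (2 ^ k)" and "X \<equiv> X_gate \<otimes>\<^sub>k 1\<^sub>m (2 ^ k)"
  shows "reduces (Suc (Suc k)) (X_gate \<otimes>\<^sub>k Z) (X_gate \<otimes>\<^sub>k 1\<^sub>m (2 ^ Suc k))"
    "reduces (Suc (Suc k)) (1\<^sub>m 2 \<otimes>\<^sub>k X) (Z_gate \<otimes>\<^sub>k X)"
proof -
  let ?d = "2 ^ Suc k :: nat" and ?C = "block_diag (1\<^sub>m (2 ^ Suc k)) Z"
  have C: "?C \<in> circuits (Suc (Suc k)) 1 1"
    using circuits_first_qubit(3) by (simp add: Z_def)
  then have CU: "?C \<in> unitary (2 ^ Suc (Suc k))"
    using circuits_unitary by blast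
  have c: "Z \<in> carrier_mat ?d ?d" "X \<in> carrier_mat ?d ?d"
    using kron_carrier2[OF gate_carrier(1) one_carrier_mat] kron_carrier2[OF gate_carrier(2) one_carrier_mat]
    by (simp_all add: Z_def X_def)
  have ZX: "Z * X = (-1) \<cdot>\<^sub>m X * Z"
  proof -
    have "Z_gate * X_gate = (-1) \<cdot>\<^sub>m (X_gate * Z_gate)"
      by (simp add: gate_mat2 mat2_simps)
    then have "Z * X = (-1) \<cdot>\<^sub>m (X * Z)"
      by (simp add: Z_def X_def kron_mult[of _ _ _ "2 ^ k"] kron_smult_left)
    also have "\<dots> = (-1) \<cdot>\<^sub>m X * Z"
      by (rule mult_smult_assoc_mat[OF c(2,1), symmetric])
    finally show ?thesis .
  qed
  have ZZ: "Z * Z = 1\<^sub>m ?d" using Z_first(2) by (simp add: Z_def)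
  have bd: "1\<^sub>m 2 \<otimes>\<^sub>k X = block_diag X X" "Z_gate \<otimes>\<^sub>k X = block_diag X ((-1) \<cdot>\<^sub>m X)"
    "X_gate \<otimes>\<^sub>k Z = block_anti Z Z" "X_gate \<otimes>\<^sub>k 1\<^sub>m ?d = block_anti (1\<^sub>m ?d) (1\<^sub>m ?d)"
    using c unfolding mat2_one gate_mat2(1,2) by (simp_all only: kron_block[of _ ?d] one_carrier_mat one_smult_mat)
  have car: "1\<^sub>m 2 \<otimes>\<^sub>k X \<in> carrier_mat (2 ^ Suc (Suc k)) (2 ^ Suc (Suc k))"
    "Z_gate \<otimes>\<^sub>k X \<in> carrier_mat (2 ^ Suc (Suc k)) (2 ^ Suc (Suc k))"
    "X_gate \<otimes>\<^sub>k Z \<in> carrier_mat (2 ^ Suc (Suc k)) (2 ^ Suc (Suc k))"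
    "X_gate \<otimes>\<^sub>k 1\<^sub>m ?d \<in> carrier_mat (2 ^ Suc (Suc k)) (2 ^ Suc (Suc k))"
    using kron_carrier2[OF _ c(1)] kron_carrier2[OF _ c(2)] kron_carrier2[OF _ one_carrier_mat[of ?d]]
    by simp_all
  have "?C * (X_gate \<otimes>\<^sub>k Z) = (X_gate \<otimes>\<^sub>k 1\<^sub>m ?d) * ?C"
    unfolding bd using c ZZ by (simp only: block_mult[of _ ?d] one_carrier_mat left_mult_one_mat[of _ ?d ?d])
  then have "conj_by ?C (X_gate \<otimes>\<^sub>k Z) = 1 \<cdot>\<^sub>m (X_gate \<otimes>\<^sub>k 1\<^sub>m ?d)"
    using conj_by_eq_iff[OF CU car(3,4)] by simp
  then show "reduces (Suc (Suc k)) (X_gate \<otimes>\<^sub>k Z) (X_gate \<otimes>\<^sub>k 1\<^sub>m ?d)"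
    by (rule reducesI[OF C, rotated]) simp
  have "?C * (1\<^sub>m 2 \<otimes>\<^sub>k X) = (Z_gate \<otimes>\<^sub>k X) * ?C"
    unfolding bd using c ZX
    by (simp only: block_mult[of _ ?d] one_carrier_mat left_mult_one_mat[of _ ?d ?d]
        right_mult_one_mat[of _ ?d ?d] smult_carrier_mat)
  then have "conj_by ?C (1\<^sub>m 2 \<otimes>\<^sub>k X) = 1 \<cdot>\<^sub>m (Z_gate \<otimes>\<^sub>k X)"
    using conj_by_eq_iff[OF CU car(1,2)] by simp
  then show "reduces (Suc (Suc k)) (1\<^sub>m 2 \<otimes>\<^sub>k X) (Z_gate \<otimes>\<^sub>k X)"
    by (rule reducesI[OF C, rotated]) simp
qed

text \<open>Transitivity of circuits on the non-scalar Pauli matrices. By induction the part after the first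
qubit is either a scalar, which leaves a one-qubit problem, or can be brought to \<open>Z\<close> on the second
qubit. In the latter case a non-trivial first factor is turned into \<open>X\<close>, after which \<open>CZ\<close> removes
the \<open>Z\<close> and \<open>H\<close> finishes. A trivial first factor is first made non-trivial along
\<open>1 \<otimes> Z\<close>, \<open>1 \<otimes> X\<close>, \<open>Z \<otimes> X\<close>, \<open>Z \<otimes> Z\<close>.\<close>
lemma pauli_reduces:
  assumes "R \<in> pauli m"
  shows "(\<exists>c. c ^ 4 = 1 \<and> R = c \<cdot>\<^sub>m 1\<^sub>m (2 ^ m)) \<or>
    (\<exists>k. m = Suc k \<and> reduces m R (Z_gate \<otimes>\<^sub>k 1\<^sub>m (2 ^ k)))"
  using assms
proof (induction m arbitrary: R)
  case 0
  then show ?case by auto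
next
  case (Suc m)
  from Suc.prems obtain \<sigma> Q where R: "\<sigma> \<in> pauli_basis" "Q \<in> pauli m" "R = \<sigma> \<otimes>\<^sub>k Q"
    by (rule pauli_SucE)
  note \<sigma> = pauli_basis_carrier[OF R(1)] and Q = pauli_carrier[OF R(2)]
  have kc: "\<tau> \<otimes>\<^sub>k P \<in> carrier_mat (2 ^ Suc m) (2 ^ Suc m)"
    if "\<tau> \<in> carrier_mat 2 2" "P \<in> carrier_mat (2 ^ m) (2 ^ m)" for \<tau> P
    using kron_carrier2[OF that] by simp
  consider c where "c ^ 4 = 1" "Q = c \<cdot>\<^sub>m 1\<^sub>m (2 ^ m)"
    | k where "m = Suc k" "reduces m Q (Z_gate \<otimes>\<^sub>k 1\<^sub>m (2 ^ k))"
    using Suc.IH[OF R(2)] by blast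
  then show ?case
  proof cases
    case 1
    show ?thesis
    proof (cases "\<sigma> = 1\<^sub>m 2")
      case True
      then show ?thesis using 1 R(3) by (auto simp: kron_smult_right kron_one_one)
    next
      case False
      have "reduces (Suc m) (\<sigma> \<otimes>\<^sub>k 1\<^sub>m (2 ^ m)) (Z_gate \<otimes>\<^sub>k 1\<^sub>m (2 ^ m))"
        by (rule reduces_trans[OF reduces_X[OF R(1) False] reduces_Z_X(2)]) (simp_all add: kc \<sigma>)
      then obtain G c' where G: "G \<in> circuits (Suc m) 1 1" "c' ^ 4 = 1"
        "conj_by G (\<sigma> \<otimes>\<^sub>k 1\<^sub>m (2 ^ m)) = c' \<cdot>\<^sub>m (Z_gate \<otimes>\<^sub>k 1\<^sub>m (2 ^ m))"
        by (auto simp: reduces_def)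
      have "conj_by G R = (c * c') \<cdot>\<^sub>m (Z_gate \<otimes>\<^sub>k 1\<^sub>m (2 ^ m))"
        using conj_by_smult[OF circuits_unitary[OF _ _ G(1)] kc[OF \<sigma> one_carrier_mat], of c]
        by (simp add: R(3) 1 kron_smult_right G(3))
      moreover have "(c * c') ^ 4 = 1" using 1 G(2) by (simp add: power_mult_distrib)
      ultimately show ?thesis using reducesI[OF G(1)] by blast
    qed
  next
    case 2
    let ?Z = "Z_gate \<otimes>\<^sub>k 1\<^sub>m (2 ^ k)" and ?X = "X_gate \<otimes>\<^sub>k 1\<^sub>m (2 ^ k)"
    have ZX: "?Z \<in> carrier_mat (2 ^ m) (2 ^ m)" "?X \<in> carrier_mat (2 ^ m) (2 ^ m)"
      using 2(1) by simp_all
    note red = reduces_trans[OF _ _ kc kc]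
    have first: "reduces (Suc m) R (\<sigma> \<otimes>\<^sub>k ?Z)"
      using reduces_lift[OF 2(2) \<sigma> Q] by (simp add: R(3))
    have non_trivial: "reduces (Suc m) (\<tau> \<otimes>\<^sub>k ?Z) (Z_gate \<otimes>\<^sub>k 1\<^sub>m (2 ^ m))"
      if \<tau>: "\<tau> \<in> pauli_basis" "\<tau> \<noteq> 1\<^sub>m 2" for \<tau>
    proof -
      have "reduces (Suc m) (\<tau> \<otimes>\<^sub>k ?Z) (X_gate \<otimes>\<^sub>k ?Z)"
        using reduces_X[OF \<tau> ZX(1)] .
      moreover have "reduces (Suc m) (X_gate \<otimes>\<^sub>k ?Z) (X_gate \<otimes>\<^sub>k 1\<^sub>m (2 ^ m))"
        using reduces_CZ(1)[of k] by (simp add: 2(1))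
      moreover have "reduces (Suc m) (X_gate \<otimes>\<^sub>k 1\<^sub>m (2 ^ m)) (Z_gate \<otimes>\<^sub>k 1\<^sub>m (2 ^ m))"
        by (rule reduces_Z_X(2)) simp
      ultimately show ?thesis
        using red pauli_basis_carrier[OF \<tau>(1)] ZX by (meson gate_carrier(1) one_carrier_mat)
    qed
    have "reduces (Suc m) (\<sigma> \<otimes>\<^sub>k ?Z) (Z_gate \<otimes>\<^sub>k 1\<^sub>m (2 ^ m))"
    proof (cases "\<sigma> = 1\<^sub>m 2")
      case False
      then show ?thesis using non_trivial R(1) by blast
    next
      case True
      have ZX_red: "reduces m ?Z ?X" "reduces m ?X ?Z"
        using reduces_Z_X[of "1\<^sub>m (2 ^ k)" k] 2(1) by simp_all
      have "reduces (Suc m) (1\<^sub>m 2 \<otimes>\<^sub>k ?Z) (1\<^sub>m 2 \<otimes>\<^sub>k ?X)"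
        by (rule reduces_lift[OF ZX_red(1) _ ZX(1)]) simp
      moreover have "reduces (Suc m) (1\<^sub>m 2 \<otimes>\<^sub>k ?X) (Z_gate \<otimes>\<^sub>k ?X)"
        using reduces_CZ(2)[of k] 2(1) by simp
      moreover have "reduces (Suc m) (Z_gate \<otimes>\<^sub>k ?X) (Z_gate \<otimes>\<^sub>k ?Z)"
        by (rule reduces_lift[OF ZX_red(2) _ ZX(2)]) simp
      moreover have "reduces (Suc m) (Z_gate \<otimes>\<^sub>k ?Z) (Z_gate \<otimes>\<^sub>k 1\<^sub>m (2 ^ m))"
        by (rule non_trivial[OF Z_X_pauli(2)]) (simp add: gate_mat2 mat2_simps)
      ultimately show ?thesis
        unfolding True using red ZX by (meson gate_carrier(2) one_carrier_mat)
    qed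
    with first have "reduces (Suc m) R (Z_gate \<otimes>\<^sub>k 1\<^sub>m (2 ^ m))"
      using reduces_trans[OF first _ pauli_carrier[OF Suc.prems] kc[OF \<sigma> ZX(1)]] by blast
    then show ?thesis by blast
  qed
qed

section \<open>Circuits generate the Clifford matrices\<close>

lemma controlled_mult:
  assumes "R \<in> carrier_mat d d" "R' \<in> carrier_mat d d"
  shows "block_diag (1\<^sub>m d) R * block_diag (1\<^sub>m d) R' = block_diag (1\<^sub>m d) (R * R')"
  using assms by (simp add: block_mult[of _ d])

text \<open>Conjugating the target of a controlled gate by \<open>A\<close> amounts to conjugating the whole gate by
\<open>1 \<otimes> A\<close>, since the control does not see \<open>A A\<^sup>\<dagger> = 1\<close>.\<close>
lemma controlled_conj:
  assumes A: "A \<in> circuits m 1 1" and b: "1 \<le> b" "b \<le> 2" and R: "R \<in> carrier_mat (2 ^ m) (2 ^ m)"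
    and "block_diag (1\<^sub>m (2 ^ m)) R \<in> circuits (Suc m) 2 b"
  shows "block_diag (1\<^sub>m (2 ^ m)) (conj_by A R) \<in> circuits (Suc m) 2 b"
proof -
  let ?d = "2 ^ m :: nat"
  have U: "A \<in> unitary ?d" using circuits_unitary[OF _ _ A] by simp
  then have c: "A \<in> carrier_mat ?d ?d" "A\<^sup>\<dagger> \<in> carrier_mat ?d ?d" by auto
  have lift: "block_diag V V \<in> circuits (Suc m) 2 b" if "V \<in> circuits m 1 1" for V
  proof -
    have "V \<in> carrier_mat ?d ?d" using circuits_unitary[OF _ _ that] by auto
    then show ?thesis
      using circuits_lift[OF that] circuits_mono[of 2 2 b 2 "Suc m"] b by (auto simp: lift_block)
  qed
  have "block_diag A A * block_diag (1\<^sub>m ?d) R * block_diag (A\<^sup>\<dagger>) (A\<^sup>\<dagger>) =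
      block_diag (A * A\<^sup>\<dagger>) (A * R * A\<^sup>\<dagger>)"
    using c R by (simp add: block_mult[of _ ?d] mult_carrier_mat[of _ ?d ?d _ ?d])
  also have "\<dots> = block_diag (1\<^sub>m ?d) (conj_by A R)"
    using unitaryD(1)[OF U] by (simp add: conj_by_def)
  finally show ?thesis
    using circuits_mult[OF circuits_mult[OF lift[OF A] assms(5)] lift[OF circuits_adjoint[OF _ _ A]]]
    by simp
qed

lemma S_first_block: "S_gate \<omega> \<otimes>\<^sub>k 1\<^sub>m d = block_diag (1\<^sub>m d) (w \<cdot>\<^sub>m 1\<^sub>m d)"
  by (simp add: gate_mat2 kron_block[of _ d])

text \<open>A controlled scalar is a power of \<open>S\<close> on the control qubit.\<close>
lemma controlled_phase:
  assumes "c ^ 4 = 1"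
  shows "block_diag (1\<^sub>m (2 ^ m)) (c \<cdot>\<^sub>m 1\<^sub>m (2 ^ m)) \<in> circuits (Suc m) a 1"
proof -
  let ?C = "\<lambda>c. block_diag (1\<^sub>m (2 ^ m)) (c \<cdot>\<^sub>m 1\<^sub>m (2 ^ m))"
  have mult: "?C (x * y) \<in> circuits (Suc m) a 1"
    if "?C x \<in> circuits (Suc m) a 1" "?C y \<in> circuits (Suc m) a 1" for x y
    using circuits_mult[OF that] by (simp add: controlled_mult smult_mult_smult[of _ "2 ^ m"])
  have 1: "?C 1 \<in> circuits (Suc m) a 1"
    using circuits_one[of "Suc m"] by (simp add: block_one)
  have w: "?C w \<in> circuits (Suc m) a 1"
    using circuits_first_qubit(2) by (simp add: S_first_block)
  have neg: "?C (-1) \<in> circuits (Suc m) a 1"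
    using mult[OF w w] by (simp only: w_square)
  have "?C (- w) \<in> circuits (Suc m) a 1"
    using mult[OF neg w] by simp
  with 1 w neg show ?thesis using phase_cases[OF assms] by auto
qed

text \<open>A non-scalar \<open>R\<close> is conjugate to a multiple of \<open>Z\<close> on the next qubit by a circuit avoiding
qubit 1; the controlled version of \<open>Z\<close> is \<open>CZ\<close>, and the multiple is a controlled scalar.\<close>
lemma controlled_pauli:
  assumes R: "R \<in> pauli m"
  shows "block_diag (1\<^sub>m (2 ^ m)) R \<in> circuits (Suc m) 2 1"
proof -
  consider c where "c ^ 4 = 1" "R = c \<cdot>\<^sub>m 1\<^sub>m (2 ^ m)"
    | k where "m = Suc k" "reduces m R (Z_gate \<otimes>\<^sub>k 1\<^sub>m (2 ^ k))"
    using pauli_reduces[OF R] by blast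
  then show ?thesis
  proof cases
    case 1
    then show ?thesis using controlled_phase by simp
  next
    case 2
    let ?Z = "Z_gate \<otimes>\<^sub>k 1\<^sub>m (2 ^ k)" and ?d = "2 ^ m :: nat"
    obtain G c where G: "G \<in> circuits m 1 1" "c ^ 4 = 1" "conj_by G R = c \<cdot>\<^sub>m ?Z"
      using 2(2) by (auto simp: reduces_def)
    have GU: "G \<in> unitary ?d" using circuits_unitary[OF _ _ G(1)] by simp
    have Z: "?Z \<in> carrier_mat ?d ?d" using Z_first(3)[of k] 2(1) by simp
    have "block_diag (1\<^sub>m ?d) ?Z * block_diag (1\<^sub>m ?d) (c \<cdot>\<^sub>m 1\<^sub>m ?d) = block_diag (1\<^sub>m ?d) (c \<cdot>\<^sub>m ?Z)"
      using Z by (simp add: controlled_mult mult_smult_distrib[of _ ?d ?d _ ?d] right_mult_one_mat[OF Z])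
    moreover have "block_diag (1\<^sub>m ?d) ?Z \<in> circuits (Suc m) 2 1"
      using circuits_first_qubit(3)[of k 2 1] by (simp add: 2(1))
    ultimately have "block_diag (1\<^sub>m ?d) (c \<cdot>\<^sub>m ?Z) \<in> circuits (Suc m) 2 1"
      using circuits_mult controlled_phase[OF G(2), of m 2] by metis
    then have "block_diag (1\<^sub>m ?d) (conj_by (G\<^sup>\<dagger>) (c \<cdot>\<^sub>m ?Z)) \<in> circuits (Suc m) 2 1"
      using Z by (intro controlled_conj circuits_adjoint G(1)) auto
    then show ?thesis
      using conj_by_inverse(1)[OF GU pauli_carrier[OF R]] by (simp add: G(3))
  qed
qed

text \<open>The structural heart of the proof. If \<open>U = diag(A, D)\<close> normalizes the Pauli group, then conjugating
\<open>diag(Q, Q)\<close> shows that \<open>A\<close> normalizes the Pauli group on one qubit less, and conjugating \<open>X\<close> on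
qubit 1 shows that \<open>R = D A\<^sup>\<dagger>\<close> is itself a Pauli matrix. So \<open>U = diag(1, R) (1 \<otimes> A)\<close> is a
controlled Pauli gate after a Clifford matrix on the remaining qubits. The hypothesis on \<open>m\<close> qubits
is stated explicitly because the lemma is also the induction step of the generation theorem.\<close>
lemma block_diag_clifford:
  assumes gen: "clifford m \<subseteq> circuits m 1 1" and U: "U \<in> clifford (Suc m)"
    and AD: "A \<in> unitary (2 ^ m)" "D \<in> unitary (2 ^ m)" "U = block_diag A D"
  shows "U \<in> circuits (Suc m) 2 1"
proof -
  let ?d = "2 ^ m :: nat"
  have c: "A \<in> carrier_mat ?d ?d" "D \<in> carrier_mat ?d ?d" "A\<^sup>\<dagger> \<in> carrier_mat ?d ?d" "D\<^sup>\<dagger> \<in> carrier_mat ?d ?d"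
    using AD by auto
  have conj: "conj_by (block_diag V W) (block_diag Q Q) = block_diag (conj_by V Q) (conj_by W Q)"
    if "V \<in> carrier_mat ?d ?d" "W \<in> carrier_mat ?d ?d" "Q \<in> carrier_mat ?d ?d" for V W Q
    using that by (simp add: conj_by_def block_adjoint[of _ ?d] block_mult[of _ ?d]
        mult_carrier_mat[of _ ?d ?d _ ?d])
  have preserves: "conj_by V Q \<in> pauli m"
    if Q: "Q \<in> pauli m" and V: "V \<in> unitary ?d" "W \<in> unitary ?d" "block_diag V W \<in> clifford (Suc m)" for Q V W
  proof -
    have "conj_by (block_diag V W) (block_diag Q Q) \<in> pauli (Suc m)"
      using cliffordD(2)[OF V(3)] pauli_Suc_blockI(1)[OF Q, of 1] by simp
    then have "block_diag (conj_by V Q) (conj_by W Q) \<in> pauli (Suc m)"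
      using conj[of V W Q] V(1,2) pauli_carrier[OF Q] by simp
    then show ?thesis
      using pauli_block_diagD V pauli_carrier[OF Q] conj_by_carrier by blast
  qed
  have "U\<^sup>\<dagger> = block_diag (A\<^sup>\<dagger>) (D\<^sup>\<dagger>)" using c by (simp add: AD(3) block_adjoint[of _ ?d])
  then have "block_diag (A\<^sup>\<dagger>) (D\<^sup>\<dagger>) \<in> clifford (Suc m)" using clifford_adjoint[OF U] by simp
  then have A: "A \<in> clifford m"
    unfolding clifford_def[of m] using preserves[OF _ AD(1,2)] U[unfolded AD(3)]
      preserves[OF _ unitary_adjoint[OF AD(1)] unitary_adjoint[OF AD(2)]] AD(1) by simp
  have X: "block_anti (1\<^sub>m ?d) (1\<^sub>m ?d) \<in> pauli (Suc m)"
    using pauli_Suc_blockI(2)[OF pauli_one, of 1] by simp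
  have "conj_by U (block_anti (1\<^sub>m ?d) (1\<^sub>m ?d)) = block_anti (A * D\<^sup>\<dagger>) (D * A\<^sup>\<dagger>)"
    using c by (simp add: conj_by_def AD(3) block_adjoint[of _ ?d] block_mult[of _ ?d])
  then have "block_anti (A * D\<^sup>\<dagger>) (D * A\<^sup>\<dagger>) \<in> pauli (Suc m)"
    using cliffordD(2)[OF U X] by simp
  then have "A * D\<^sup>\<dagger> \<in> pauli m \<and> (\<exists>s\<in>{1, -1}. D * A\<^sup>\<dagger> = s \<cdot>\<^sub>m (A * D\<^sup>\<dagger>))"
    using c by (intro pauli_block_antiD) (auto intro: mult_carrier_mat)
  then have R: "D * A\<^sup>\<dagger> \<in> pauli m"
    using pauli_smult sign_phase by force
  have DA: "D * A\<^sup>\<dagger> * A = D"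
    using c unitaryD(2)[OF AD(1)] by (simp add: assoc_mult_mat[of _ ?d ?d _ ?d _ ?d])
  have "U = block_diag (1\<^sub>m ?d) (D * A\<^sup>\<dagger>) * (1\<^sub>m 2 \<otimes>\<^sub>k A)"
    using block_mult(1)[OF one_carrier_mat mult_carrier_mat[OF c(2,3)] c(1,1)] c
    by (simp only: AD(3) lift_block[OF c(1)] DA left_mult_one_mat)
  moreover have "1\<^sub>m 2 \<otimes>\<^sub>k A \<in> circuits (Suc m) 2 1"
    using circuits_lift[of A m] circuits_mono[of 2 2 1 2 "Suc m"] gen A by auto
  ultimately show ?thesis
    using circuits_mult[OF controlled_pauli[OF R]] by simp
qed

text \<open>Given \<open>U\<close>, the Pauli matrix \<open>U Z\<^sub>1 U\<^sup>\<dagger>\<close> is not scalar, so a circuit \<open>G\<close> takes it back to a multiple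
of \<open>Z\<^sub>1\<close>. Then \<open>V = G U\<close> commutes with \<open>Z\<^sub>1\<close> up to a scalar, hence \<open>V\<close> or \<open>X\<^sub>1 V\<close> is block
diagonal and therefore a circuit by the factorization above.\<close>
theorem clifford_generated: "clifford m \<subseteq> circuits m 1 1"
proof (induction m)
  case 0
  show ?case
  proof
    fix U assume "U \<in> clifford 0"
    then have U: "U \<in> unitary 1" using cliffordD(1)[of U 0] by simp
    have U_eq: "U = U $$ (0, 0) \<cdot>\<^sub>m 1\<^sub>m 1"
      using unitary_dim[OF U] by (intro eq_matI) auto
    have "(U $$ (0, 0) * cnj (U $$ (0, 0))) \<cdot>\<^sub>m 1\<^sub>m 1 = 1 \<cdot>\<^sub>m (1\<^sub>m 1 :: complex mat)"
      using unitaryD(1)[OF U] by (subst (asm) (1 2) U_eq) (simp add: smult_mult_smult[of _ 1])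
    from smult_eq_unitary[OF this unitary_one] have "cmod (U $$ (0, 0)) = 1"
      by (simp add: cmod_one_iff)
    then show "U \<in> circuits 0 1 1"
      using circuits_scalar[of "U $$ (0, 0)" 0 1 1] U_eq by simp
  qed
next
  case (Suc m)
  let ?d = "2 ^ m :: nat" and ?Z = "Z_gate \<otimes>\<^sub>k 1\<^sub>m (2 ^ m)"
  show ?case
  proof
    fix U assume U: "U \<in> clifford (Suc m)"
    note UU = cliffordD(1)[OF U]
    note Z = Z_first(3)[of m]
    have not_scalar: "conj_by U ?Z \<noteq> c \<cdot>\<^sub>m 1\<^sub>m (2 ^ Suc m)" for c
    proof
      assume "conj_by U ?Z = c \<cdot>\<^sub>m 1\<^sub>m (2 ^ Suc m)"
      then have "?Z = c \<cdot>\<^sub>m 1\<^sub>m (2 ^ Suc m)"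
        using conj_by_inverse(1)[OF UU Z] conj_by_of_scalar[OF unitary_adjoint[OF UU], of c] by simp
      then have "block_diag (1\<^sub>m ?d) ((-1) \<cdot>\<^sub>m 1\<^sub>m ?d) = block_diag (c \<cdot>\<^sub>m 1\<^sub>m ?d) (c \<cdot>\<^sub>m 1\<^sub>m ?d)"
        by (simp add: gate_mat2 kron_block[of _ ?d] block_one[symmetric] block_smult[of _ ?d])
      then have "1 \<cdot>\<^sub>m 1\<^sub>m ?d = (-1) \<cdot>\<^sub>m (1\<^sub>m ?d :: complex mat)"
        by (simp add: block_inject[of _ ?d])
      from smult_eq_unitary[OF this unitary_one] show False by simp
    qed
    then obtain G c where G: "G \<in> circuits (Suc m) 1 1" "conj_by G (conj_by U ?Z) = c \<cdot>\<^sub>m ?Z"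
      using pauli_reduces[OF cliffordD(2)[OF U Z_first(1)]] by (auto simp: reduces_def)
    have GC: "G \<in> clifford (Suc m)" using circuits_clifford[of 1 1] G(1) by auto
    let ?V = "G * U"
    have V: "?V \<in> clifford (Suc m)" using clifford_mult[OF GC U] .
    note VU = cliffordD(1)[OF V]
    have "conj_by ?V ?Z = c \<cdot>\<^sub>m ?Z"
      using G(2) conj_by_comp[OF cliffordD(1)[OF GC] UU Z] by simp
    then have "?V * ?Z = c \<cdot>\<^sub>m ?Z * ?V"
      using conj_by_eq_iff[OF VU Z] Z by simp
    then have comm: "?V * ?Z = c \<cdot>\<^sub>m (?Z * ?V)"
      using mult_smult_assoc_mat[OF Z clifford_carrier[OF V]] by simp
    have "?V \<in> circuits (Suc m) 1 1"
    proof (rule commute_first_qubit_cases[of ?V ?d "-1" c])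
      show "?V \<in> unitary (2 * ?d)" using VU by simp
      show "?V * (mat2 1 0 0 (-1) \<otimes>\<^sub>k 1\<^sub>m ?d) = c \<cdot>\<^sub>m ((mat2 1 0 0 (-1) \<otimes>\<^sub>k 1\<^sub>m ?d) * ?V)"
        using comm by (simp add: gate_mat2)
    next
      fix A D assume "A \<in> unitary ?d" "D \<in> unitary ?d" "?V = block_diag A D"
      then show ?thesis
        using block_diag_clifford[OF Suc.IH V] circuits_mono[of 1 2 1 1] by auto
    next
      fix B C assume BC: "B \<in> unitary ?d" "C \<in> unitary ?d" "?V = block_anti B C"
      let ?H = "H_gate \<otimes>\<^sub>k 1\<^sub>m ?d" and ?S = "S_gate \<omega> \<otimes>\<^sub>k 1\<^sub>m ?d" and ?X = "X_gate \<otimes>\<^sub>k 1\<^sub>m ?d"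
      \<comment> \<open>\<open>S\<close> squares to \<open>Z\<close>, which \<open>H\<close> conjugates to \<open>X\<close>.\<close>
      have "?X = ?H * (?S * ?S) * ?H"
        using H_local by (simp add: kron_mult[of _ _ _ ?d] S_local(4) conj_by_def mult_carrier_mat[of _ 2 2 _ 2])
      then have X: "?X \<in> circuits (Suc m) 1 1"
        using circuits_first_qubit(1)[of m 1] circuits_first_qubit(2)[of m 1] circuits_mult by metis
      then have XC: "?X \<in> clifford (Suc m)" using circuits_clifford[of 1 1] by auto
      have X_block: "?X = block_anti (1\<^sub>m ?d) (1\<^sub>m ?d)"
        by (simp add: gate_mat2 kron_block[of _ ?d])
      have "?X * ?V = block_diag C B"
        using BC by (simp add: X_block block_mult[of _ ?d] left_mult_one_mat[OF unitary_carrier_mat])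
      then have XV: "?X * ?V \<in> circuits (Suc m) 1 1"
        using block_diag_clifford[OF Suc.IH clifford_mult[OF XC V] BC(2,1)] circuits_mono[of 1 2 1 1] by auto
      have "?X * ?X = 1\<^sub>m (2 ^ Suc m)"
        by (simp add: X_block block_mult[of _ ?d] block_one)
      then have "?X * (?X * ?V) = ?V"
        using assoc_mult_mat[OF clifford_carrier[OF XC] clifford_carrier[OF XC] clifford_carrier[OF V]]
          left_mult_one_mat[OF clifford_carrier[OF V]] by simp
      then show ?thesis using circuits_mult[OF X XV] by simp
    qed auto
    moreover have "G\<^sup>\<dagger> * ?V = U"
      using unitary_cancel(2)[OF cliffordD(1)[OF GC] clifford_carrier[OF U]] .
    ultimately show "U \<in> circuits (Suc m) 1 1"
      using circuits_mult[OF circuits_adjoint[OF _ _ G(1)]] by (metis le_refl)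
  qed
qed

text \<open>Controlled gates with the same control multiply like their targets. With \<open>Y = S X S\<^sup>\<dagger>\<close> the product
\<open>Y Z X\<close> is the scalar \<open>\<omega>\<^sup>2\<close>, so the controlled \<open>Y\<close>, \<open>Z\<close> and \<open>X\<close>, all obtained from \<open>CZ\<close> by
conjugation with gates on the second qubit, multiply to \<open>S\<close> on the control qubit.\<close>
lemma S_first_omitted: "circuits (Suc (Suc k)) 2 1 = circuits (Suc (Suc k)) 2 2"
proof
  let ?d = "2 ^ k :: nat" and ?e = "2 ^ Suc k :: nat"
  let ?C = "\<lambda>R. block_diag (1\<^sub>m ?e) R" and ?n = "Suc (Suc k)"
  have Z: "?C (Z_gate \<otimes>\<^sub>k 1\<^sub>m ?d) \<in> circuits ?n 2 2"
    using circuits_first_qubit(3) .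
  have car: "A \<otimes>\<^sub>k 1\<^sub>m ?d \<in> carrier_mat ?e ?e" if "A \<in> carrier_mat 2 2" for A
    using kron_carrier2[OF that one_carrier_mat] by simp
  have conj: "conj_by (A \<otimes>\<^sub>k 1\<^sub>m ?d) (B \<otimes>\<^sub>k 1\<^sub>m ?d) = conj_by A B \<otimes>\<^sub>k 1\<^sub>m ?d"
    if "A \<in> unitary 2" "B \<in> carrier_mat 2 2" for A B
    using that by (simp add: conj_by_kron[of _ _ ?d])
  have X: "?C (X_gate \<otimes>\<^sub>k 1\<^sub>m ?d) \<in> circuits ?n 2 2"
    using controlled_conj[OF circuits_first_qubit(1)[of k 1] _ _ car[OF gate_carrier(2)] Z]
    by (simp add: conj H_local)
  let ?Y = "conj_by (S_gate \<omega>) X_gate"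
  have Yc: "?Y \<in> carrier_mat 2 2" by simp
  have Y: "?C (?Y \<otimes>\<^sub>k 1\<^sub>m ?d) \<in> circuits ?n 2 2"
    using controlled_conj[OF circuits_first_qubit(2)[of k 1] _ _ car[OF gate_carrier(1)] X]
    by (simp add: conj)
  have "?Y * Z_gate * X_gate = w \<cdot>\<^sub>m 1\<^sub>m 2"
    by (simp only: S_local(5)) (simp add: gate_mat2(1,2) mat2_simps)
  then have "(?Y \<otimes>\<^sub>k 1\<^sub>m ?d) * (Z_gate \<otimes>\<^sub>k 1\<^sub>m ?d) * (X_gate \<otimes>\<^sub>k 1\<^sub>m ?d) = w \<cdot>\<^sub>m 1\<^sub>m ?e"
    by (simp add: kron_mult[of _ _ _ ?d] mult_carrier_mat[of _ 2 2 _ 2] kron_smult_left kron_one_one)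
  then have "?C (?Y \<otimes>\<^sub>k 1\<^sub>m ?d) * ?C (Z_gate \<otimes>\<^sub>k 1\<^sub>m ?d) * ?C (X_gate \<otimes>\<^sub>k 1\<^sub>m ?d) = S_gate \<omega> \<otimes>\<^sub>k 1\<^sub>m ?e"
    using controlled_mult[OF car[OF Yc] car[OF gate_carrier(2)]]
      controlled_mult[OF mult_carrier_mat[OF car[OF Yc] car[OF gate_carrier(2)]] car[OF gate_carrier(1)]]
    by (simp only: S_first_block)
  then have S: "S_gate \<omega> \<otimes>\<^sub>k 1\<^sub>m ?e \<in> circuits ?n 2 2"
    using circuits_mult[OF circuits_mult[OF Y Z] X] by simp
  have "gate_set ?n 2 1 = insert (S_gate \<omega> \<otimes>\<^sub>k 1\<^sub>m ?e) (gate_set ?n 2 2)"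
  proof -
    have range: "{1..?n} = insert 1 {2..?n}" by auto
    have "{f i | i. i \<in> {1..?n}} = insert (f 1) {f i | i. i \<in> {2..?n}}" for f :: "nat \<Rightarrow> complex mat"
      unfolding range by blast
    from this[of "\<lambda>i. on_qubit ?n i (S_gate \<omega>)"] show ?thesis
      unfolding gate_set_def on_qubit_first by blast
  qed
  moreover have "subgroup (circuits ?n 2 2) (unitary_group (2 ^ ?n))"
    unfolding circuits_def by (intro unitary_group.generate_is_subgroup generators_unitary) simp_all
  moreover have "insert (S_gate \<omega> \<otimes>\<^sub>k 1\<^sub>m ?e) (gate_set ?n 2 2) \<union> unit_scalars ?n \<subseteq> circuits ?n 2 2"
    using S gate_set_circuits unit_scalars_circuits by blast
  ultimately show "circuits ?n 2 1 \<subseteq> circuits ?n 2 2"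
    unfolding circuits_def[of ?n 2 1] by (metis unitary_group.generate_subgroup_incl)
  show "circuits ?n 2 2 \<subseteq> circuits ?n 2 1"
    by (rule circuits_mono) auto
qed

end

section \<open>The Pauli group and its normalizer\<close>

lemma pauli_subgroup: "subgroup (pauli m) (unitary_group (2 ^ m))"
  by (intro unitary_group.subgroupI)
    (auto simp: pauli_unitary unitary_inv pauli_adjoint pauli_mult intro: pauli_one)

lemma on_qubit_pauli:
  assumes "\<sigma> \<in> pauli_basis" "i \<in> {1..n}"
  shows "on_qubit n i \<sigma> \<in> pauli n"
  using assms(2)
proof (induction n arbitrary: i)
  case (Suc n)
  show ?case
  proof (cases "i = 1")
    case True
    then show ?thesis using pauli_SucI[OF assms(1) pauli_one] by (simp only: on_qubit_first)
  next
    case False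
    with Suc.prems obtain j where "i = Suc j" "j \<in> {1..n}" by (cases i) auto
    then show ?thesis using pauli_SucI[OF pauli_basis_one Suc.IH] by (simp add: on_qubit_Suc)
  qed
qed simp

context eighth_root
begin

definition pauli_gens :: "nat \<Rightarrow> complex mat set" where
  "pauli_gens n = {on_qubit n i X_gate | i. i \<in> {1..n}} \<union> {on_qubit n i Z_gate | i. i \<in> {1..n}}
      \<union> {w \<cdot>\<^sub>m kron_pow (1\<^sub>m 2) n}"

lemma pauli_gens_pauli: "pauli_gens n \<subseteq> pauli n"
  using on_qubit_pauli[OF Z_X_pauli(1)] on_qubit_pauli[OF Z_X_pauli(2)] pauli_smult[OF pauli_one w_phase]
  by (auto simp: pauli_gens_def kron_pow_one)

lemma pauli_gens_lift: "(\<otimes>\<^sub>k) (1\<^sub>m 2) ` pauli_gens n \<subseteq> pauli_gens (Suc n)"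
proof -
  have "1\<^sub>m 2 \<otimes>\<^sub>k on_qubit n i \<sigma> \<in> {on_qubit (Suc n) i \<sigma> | i. i \<in> {1..Suc n}}" if "i \<in> {1..n}" for i \<sigma>
    using that by (auto simp: on_qubit_Suc intro!: exI[of _ "Suc i"])
  moreover have "1\<^sub>m 2 \<otimes>\<^sub>k (w \<cdot>\<^sub>m kron_pow (1\<^sub>m 2) n) = w \<cdot>\<^sub>m kron_pow (1\<^sub>m 2) (Suc n)"
    by (simp only: kron_smult_right kron_pow_one_Suc)
  ultimately show ?thesis unfolding pauli_gens_def by blast
qed

text \<open>Split off the first factor: it is one of \<open>1\<close>, \<open>X\<close>, \<open>Z\<close> and \<open>X Z\<close> on qubit 1, and the rest lies
in the image of the smaller Pauli group. The phases come from the scalar generator in dimension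
one.\<close>
lemma pauli_generated: "P \<in> pauli n \<Longrightarrow> P \<in> generate (unitary_group (2 ^ n)) (pauli_gens n)"
proof (induction n arbitrary: P)
  case 0
  let ?E = "generate (unitary_group 1) (pauli_gens 0)"
  obtain c where c: "P = c \<cdot>\<^sub>m 1\<^sub>m 1" "c ^ 4 = 1" using 0 by auto
  have mult: "(x * y) \<cdot>\<^sub>m 1\<^sub>m 1 \<in> ?E" if "x \<cdot>\<^sub>m 1\<^sub>m 1 \<in> ?E" "y \<cdot>\<^sub>m 1\<^sub>m 1 \<in> ?E" for x y
    using generate.eng[OF that] by (simp add: smult_mult_smult[of _ 1])
  have one: "1 \<cdot>\<^sub>m 1\<^sub>m 1 \<in> ?E"
    using generate.one[of "unitary_group 1" "pauli_gens 0"] by simp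
  have w: "w \<cdot>\<^sub>m 1\<^sub>m 1 \<in> ?E"
    by (rule generate.incl) (simp add: pauli_gens_def)
  have neg: "(-1) \<cdot>\<^sub>m 1\<^sub>m 1 \<in> ?E"
    using mult[OF w w] by (simp only: w_square)
  have "(- w) \<cdot>\<^sub>m 1\<^sub>m 1 \<in> ?E"
    using mult[OF neg w] by simp
  with one w neg have "P \<in> ?E" using phase_cases[OF c(2)] c(1) by auto
  then show ?case by simp
next
  case (Suc n)
  let ?E = "generate (unitary_group (2 ^ Suc n)) (pauli_gens (Suc n))"
  interpret lift: group_hom "unitary_group (2 ^ n)" "unitary_group (2 * 2 ^ n)" "(\<otimes>\<^sub>k) (1\<^sub>m 2)"
    by (rule lift_group_hom)
  from Suc.prems obtain \<sigma> Q where P: "\<sigma> \<in> pauli_basis" "Q \<in> pauli n" "P = \<sigma> \<otimes>\<^sub>k Q"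
    by (rule pauli_SucE)
  have "pauli_gens n \<subseteq> unitary (2 ^ n)"
    using pauli_gens_pauli pauli_unitary by blast
  from lift.generate_img[OF this] have "1\<^sub>m 2 \<otimes>\<^sub>k Q \<in> generate (unitary_group (2 * 2 ^ n)) ((\<otimes>\<^sub>k) (1\<^sub>m 2) ` pauli_gens n)"
    using Suc.IH[OF P(2)] by blast
  then have Q: "1\<^sub>m 2 \<otimes>\<^sub>k Q \<in> ?E"
    using unitary_group.mono_generate[OF pauli_gens_lift] by auto
  have X: "X_gate \<otimes>\<^sub>k 1\<^sub>m (2 ^ n) \<in> ?E" and Z: "Z_gate \<otimes>\<^sub>k 1\<^sub>m (2 ^ n) \<in> ?E"
    by (rule generate.incl; force simp: pauli_gens_def on_qubit_first[symmetric])+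
  have XZ: "(X_gate * Z_gate) \<otimes>\<^sub>k 1\<^sub>m (2 ^ n) \<in> ?E"
    using generate.eng[OF X Z] by (simp add: kron_mult[of _ _ _ "2 ^ n"])
  have one: "1\<^sub>m 2 \<otimes>\<^sub>k 1\<^sub>m (2 ^ n) \<in> ?E"
    using generate.one[of "unitary_group (2 ^ Suc n)"] by (simp add: kron_one_one)
  have "\<sigma> \<in> {1\<^sub>m 2, X_gate, Z_gate, X_gate * Z_gate}"
    using P(1) by (auto simp: pauli_basis_def gate_mat2 mat2_simps)
  then have "\<sigma> \<otimes>\<^sub>k 1\<^sub>m (2 ^ n) \<in> ?E"
    using X Z XZ one by auto
  moreover have "P = (\<sigma> \<otimes>\<^sub>k 1\<^sub>m (2 ^ n)) * (1\<^sub>m 2 \<otimes>\<^sub>k Q)"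
    using pauli_basis_carrier[OF P(1)] pauli_carrier[OF P(2)] by (simp add: P(3) kron_mult[of _ _ _ "2 ^ n"])
  ultimately show ?case using generate.eng[OF _ Q] by simp
qed

lemma pauli_group_eq: "pauli_group \<omega> n = pauli n"
proof -
  have "pauli_group \<omega> n = generate (unitary_group (2 ^ n)) (pauli_gens n)"
    by (simp add: pauli_group_def pauli_gens_def)
  then show ?thesis
    using unitary_group.generate_subgroup_incl[OF pauli_gens_pauli pauli_subgroup] pauli_generated by blast
qed

lemma normalizer_eq: "normalizer (unitary_group (2 ^ n)) (pauli n) = clifford n"
proof -
  have sub: "pauli n \<subseteq> unitary (2 ^ n)" using pauli_unitary by blast
  have conj: "g <#\<^bsub>unitary_group (2 ^ n)\<^esub> pauli n #>\<^bsub>unitary_group (2 ^ n)\<^esub> (inv\<^bsub>unitary_group (2 ^ n)\<^esub> g)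
      = conj_by g ` pauli n" if "g \<in> unitary (2 ^ n)" for g
    using that by (auto simp: l_coset_def r_coset_def unitary_inv conj_by_def)
  have stable: "conj_by g ` pauli n = pauli n \<longleftrightarrow> (\<forall>P\<in>pauli n. conj_by g P \<in> pauli n \<and> conj_by (g\<^sup>\<dagger>) P \<in> pauli n)"
    if "g \<in> unitary (2 ^ n)" for g
  proof
    assume eq: "conj_by g ` pauli n = pauli n"
    have "conj_by (g\<^sup>\<dagger>) P \<in> pauli n" if "P \<in> pauli n" for P
    proof -
      obtain Q where "Q \<in> pauli n" "P = conj_by g Q" using eq \<open>P \<in> pauli n\<close> by blast
      then show ?thesis using conj_by_inverse(1)[OF \<open>g \<in> unitary (2 ^ n)\<close> pauli_carrier] by simp
    qed
    with eq show "\<forall>P\<in>pauli n. conj_by g P \<in> pauli n \<and> conj_by (g\<^sup>\<dagger>) P \<in> pauli n" by blast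
  next
    assume *: "\<forall>P\<in>pauli n. conj_by g P \<in> pauli n \<and> conj_by (g\<^sup>\<dagger>) P \<in> pauli n"
    have "P \<in> conj_by g ` pauli n" if "P \<in> pauli n" for P
      using conj_by_inverse(2)[OF \<open>g \<in> unitary (2 ^ n)\<close> pauli_carrier[OF that]] * that
      by (metis imageI)
    with * show "conj_by g ` pauli n = pauli n" by blast
  qed
  have "normalizer (unitary_group (2 ^ n)) (pauli n) =
      {g \<in> unitary (2 ^ n). conj_by g ` pauli n = pauli n}"
    unfolding normalizer_def stabilizer_def using sub by (intro Collect_cong conj_cong refl) (simp add: conj)
  also have "\<dots> = clifford n"
    unfolding clifford_def by (intro Collect_cong conj_cong refl stable)
  finally show ?thesis .
qed

lemma pauli_normalizer_eq: "pauli_normalizer \<omega> n = (unitary_group (2 ^ n))\<lparr>carrier := clifford n\<rparr>"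
  by (simp add: pauli_normalizer_def pauli_group_eq normalizer_eq)

end

section \<open>Opposite groups and centralizers\<close>

text \<open>Products in the projective Clifford group are read in circuit order, which makes it the opposite of
the quotient of a matrix group. Generated subgroups, centralizers and normality are the same in a
group and its opposite, so everything can be computed with ordinary matrix products.\<close>
definition opposite :: "('a, 'b) monoid_scheme \<Rightarrow> ('a, 'b) monoid_scheme" where
  "opposite G = G\<lparr>monoid.mult := \<lambda>x y. y \<otimes>\<^bsub>G\<^esub> x\<rparr>"

lemma opposite_simps [simp]:
  "carrier (opposite G) = carrier G" "\<one>\<^bsub>opposite G\<^esub> = \<one>\<^bsub>G\<^esub>"
  "x \<otimes>\<^bsub>opposite G\<^esub> y = y \<otimes>\<^bsub>G\<^esub> x"
  by (simp_all add: opposite_def)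

lemma opposite_carrier_update: "(opposite G)\<lparr>carrier := K\<rparr> = opposite (G\<lparr>carrier := K\<rparr>)"
  by (simp add: opposite_def)

lemma m_inv_opposite: "inv\<^bsub>opposite G\<^esub> x = inv\<^bsub>G\<^esub> x"
  unfolding m_inv_def by (simp add: conj_commute)

lemma group_opposite: "group G \<Longrightarrow> group (opposite G)"
  by (intro groupI) (auto simp: group.is_monoid monoid.m_closed monoid.m_assoc
      intro: group.r_inv group.inv_closed)

lemma generate_opposite: "generate (opposite G) K = generate G K"
proof -
  have "x \<in> generate (opposite G) K" if "x \<in> generate G K" for x
    using that
  proof (induction rule: generate.induct)
    case (eng h1 h2)
    then show ?case using generate.eng[of h2 "opposite G" K h1] by simp
  qed (use generate.one[of "opposite G"] generate.inv[of _ K "opposite G"] in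
      \<open>auto simp: m_inv_opposite intro: generate.incl\<close>)
  moreover have "x \<in> generate G K" if "x \<in> generate (opposite G) K" for x
    using that
  proof (induction rule: generate.induct)
    case (eng h1 h2)
    then show ?case using generate.eng[of h2 G K h1] by simp
  qed (auto simp: m_inv_opposite intro: generate.intros)
  ultimately show ?thesis by blast
qed

lemma centralizer_opposite: "centralizer (opposite G) x = centralizer G x"
  by (auto simp: centralizer_def)

lemma subgroup_opposite: "subgroup H G \<Longrightarrow> subgroup H (opposite G)"
  by (auto simp: subgroup_def m_inv_opposite)

lemma normal_opposite:
  assumes "N \<lhd> G"
  shows "N \<lhd> opposite G"
proof (rule group.normalI)
  interpret normal N G by (rule assms)
  show "group (opposite G)" by (rule group_opposite) (rule is_group)
  show "subgroup N (opposite G)" by (rule subgroup_opposite) (rule subgroup_axioms)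
  show "\<forall>x\<in>carrier (opposite G). N #>\<^bsub>opposite G\<^esub> x = x <#\<^bsub>opposite G\<^esub> N"
    using coset_eq by (simp add: r_coset_def l_coset_def)
qed

lemma (in group) centralizer_subgroup:
  assumes "u \<in> carrier G"
  shows "subgroup (centralizer G u) G"
proof (rule subgroupI)
  fix x y assume xy: "x \<in> centralizer G u" "y \<in> centralizer G u"
  then have c: "x \<in> carrier G" "u \<otimes> x = x \<otimes> u" "y \<in> carrier G" "u \<otimes> y = y \<otimes> u"
    by (auto simp: centralizer_def)
  have "u \<otimes> (x \<otimes> y) = x \<otimes> u \<otimes> y"
    using c assms by (simp add: m_assoc[symmetric])
  also have "\<dots> = x \<otimes> y \<otimes> u"
    using c assms by (simp add: m_assoc)
  finally show "x \<otimes> y \<in> centralizer G u" using c by (simp add: centralizer_def)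
next
  fix x assume x: "x \<in> centralizer G u"
  then have c: "x \<in> carrier G" "u \<otimes> x = x \<otimes> u" by (auto simp: centralizer_def)
  have "inv x \<otimes> u = inv x \<otimes> (u \<otimes> x) \<otimes> inv x"
    using c(1) assms by (simp add: m_assoc)
  also have "\<dots> = u \<otimes> inv x"
    unfolding c(2) using c(1) assms by (simp add: m_assoc[symmetric])
  finally show "inv x \<in> centralizer G u" using c(1) by (simp add: centralizer_def)
qed (use assms in \<open>auto simp: centralizer_def\<close>)

context eighth_root
begin

section \<open>The projective Clifford group\<close>

lemma clifford_group: "group ((unitary_group (2 ^ n))\<lparr>carrier := clifford n\<rparr>)"
  by (rule unitary_group.subgroup_imp_group[OF clifford_subgroup])

abbreviation Cliff_mat :: "nat \<Rightarrow> complex mat monoid" where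
  "Cliff_mat n \<equiv> pauli_normalizer \<omega> n"

lemma Cliff_mat_simps [simp]:
  "carrier (Cliff_mat n) = clifford n" "x \<otimes>\<^bsub>Cliff_mat n\<^esub> y = x * y" "\<one>\<^bsub>Cliff_mat n\<^esub> = 1\<^sub>m (2 ^ n)"
  by (simp_all add: pauli_normalizer_eq)

lemma Cliff_mat_group: "group (Cliff_mat n)"
  unfolding pauli_normalizer_eq by (rule clifford_group)

lemma Cliff_mat_inv: "V \<in> clifford n \<Longrightarrow> inv\<^bsub>Cliff_mat n\<^esub> V = V\<^sup>\<dagger>"
  by (rule group.inv_equality[OF Cliff_mat_group])
    (simp_all add: clifford_adjoint unitaryD[OF cliffordD(1)])

lemma unit_scalars_normal: "unit_scalars n \<lhd> Cliff_mat n"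
proof (rule group.normal_invI[OF Cliff_mat_group])
  show "subgroup (unit_scalars n) (Cliff_mat n)"
  proof (rule group.subgroupI[OF Cliff_mat_group])
    show "unit_scalars n \<subseteq> carrier (Cliff_mat n)"
      by (auto simp: unit_scalars_def clifford_scalar)
    show "unit_scalars n \<noteq> {}"
      by (auto simp: unit_scalars_def intro: exI[of _ 1])
    fix a assume a: "a \<in> unit_scalars n"
    then obtain c where c: "a = c \<cdot>\<^sub>m 1\<^sub>m (2 ^ n)" "cmod c = 1" by (auto simp: unit_scalars_def)
    then have "inv\<^bsub>Cliff_mat n\<^esub> a = cnj c \<cdot>\<^sub>m 1\<^sub>m (2 ^ n)" by (simp add: Cliff_mat_inv clifford_scalar)
    moreover have "cmod (cnj c) = 1" using c(2) by simp
    ultimately show "inv\<^bsub>Cliff_mat n\<^esub> a \<in> unit_scalars n" unfolding unit_scalars_def by blast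
    fix b assume "b \<in> unit_scalars n"
    then obtain c' where c': "b = c' \<cdot>\<^sub>m 1\<^sub>m (2 ^ n)" "cmod c' = 1" by (auto simp: unit_scalars_def)
    have "a \<otimes>\<^bsub>Cliff_mat n\<^esub> b = (c * c') \<cdot>\<^sub>m 1\<^sub>m (2 ^ n)"
      by (simp add: c c' smult_mult_smult[of _ "2 ^ n"])
    moreover have "cmod (c * c') = 1" using c(2) c'(2) by (simp add: norm_mult)
    ultimately show "a \<otimes>\<^bsub>Cliff_mat n\<^esub> b \<in> unit_scalars n" unfolding unit_scalars_def by blast
  qed
next
  fix x h assume x: "x \<in> carrier (Cliff_mat n)" and "h \<in> unit_scalars n"
  then obtain c where "h = c \<cdot>\<^sub>m 1\<^sub>m (2 ^ n)" "cmod c = 1"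
    by (auto simp: unit_scalars_def)
  with x show "x \<otimes>\<^bsub>Cliff_mat n\<^esub> h \<otimes>\<^bsub>Cliff_mat n\<^esub> inv\<^bsub>Cliff_mat n\<^esub> x \<in> unit_scalars n"
    using conj_by_of_scalar[OF cliffordD(1), of x n c]
    by (auto simp: Cliff_mat_inv conj_by_def unit_scalars_def)
qed

abbreviation Cliff_mod :: "nat \<Rightarrow> complex mat set monoid" where
  "Cliff_mod n \<equiv> Cliff_mat n Mod unit_scalars n"

lemma proj_cliff_eq: "proj_cliff \<omega> n = opposite (Cliff_mod n)"
  by (simp add: proj_cliff_def opposite_def Let_def)

lemma Cliff_mod_group: "group (Cliff_mod n)"
  by (rule normal.factorgroup_is_group[OF unit_scalars_normal])

lemma proj_hom: "group_hom (Cliff_mat n) (Cliff_mod n) (proj_class \<omega> n)"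
proof -
  have "(\<lambda>V. unit_scalars n #>\<^bsub>Cliff_mat n\<^esub> V) \<in> hom (Cliff_mat n) (Cliff_mod n)"
    by (rule normal.r_coset_hom_Mod[OF unit_scalars_normal])
  then show ?thesis
    unfolding group_hom_def group_hom_axioms_def proj_class_def[abs_def] using Cliff_mat_group Cliff_mod_group by blast
qed

lemma Cliff_mod_carrier: "carrier (Cliff_mod n) = proj_class \<omega> n ` clifford n"
  by (simp add: carrier_FactGroup proj_class_def)

lemma proj_class_mult:
  "V \<in> clifford n \<Longrightarrow> W \<in> clifford n \<Longrightarrow> proj_class \<omega> n V \<otimes>\<^bsub>Cliff_mod n\<^esub> proj_class \<omega> n W = proj_class \<omega> n (V * W)"
  using group_hom.hom_mult[OF proj_hom, of V n W] by simp

lemma proj_class_eqD: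
  assumes "proj_class \<omega> n V = proj_class \<omega> n W" "V \<in> clifford n" "W \<in> clifford n"
  obtains c where "V = c \<cdot>\<^sub>m W"
proof -
  have "V \<in> unit_scalars n #>\<^bsub>Cliff_mat n\<^esub> W"
    using group.repr_independenceD[OF Cliff_mat_group normal_imp_subgroup[OF unit_scalars_normal], of V n W] assms
    by (simp add: proj_class_def)
  then obtain c where "V = (c \<cdot>\<^sub>m 1\<^sub>m (2 ^ n)) * W"
    by (auto simp: r_coset_def unit_scalars_def)
  then have "V = c \<cdot>\<^sub>m W"
    using clifford_carrier[OF assms(3)] by (simp add: mult_smult_assoc_mat[of _ "2 ^ n" "2 ^ n" _ "2 ^ n"])
  then show thesis by (rule that)
qed

text \<open>The scalars among the generators of the circuits become trivial in the quotient.\<close>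
lemma proj_class_circuits:
  assumes "a \<ge> 1" "b \<ge> 1"
  shows "proj_class \<omega> n ` circuits n a b = generate (Cliff_mod n) (proj_class \<omega> n ` gate_set n a b)"
proof -
  interpret group_hom "Cliff_mat n" "Cliff_mod n" "proj_class \<omega> n" by (rule proj_hom)
  let ?K = "gate_set n a b \<union> unit_scalars n"
  have K: "?K \<subseteq> clifford n"
    using gate_set_clifford[OF assms] by (auto simp: unit_scalars_def clifford_scalar)
  have "circuits n a b = generate (Cliff_mat n) ?K"
    unfolding circuits_def pauli_normalizer_eq
    using unitary_group.generate_consistent[OF K clifford_subgroup] by simp
  then have "proj_class \<omega> n ` circuits n a b = generate (Cliff_mod n) (proj_class \<omega> n ` ?K)"
    using generate_img[of ?K] K by simp
  also have "\<dots> = generate (Cliff_mod n) (proj_class \<omega> n ` gate_set n a b)"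
  proof
    have "proj_class \<omega> n V = \<one>\<^bsub>Cliff_mod n\<^esub>" if "V \<in> unit_scalars n" for V
      using that group.coset_join2[OF Cliff_mat_group _ normal_imp_subgroup[OF unit_scalars_normal] that]
      by (auto simp: proj_class_def unit_scalars_def clifford_scalar)
    then have "proj_class \<omega> n ` ?K \<subseteq> generate (Cliff_mod n) (proj_class \<omega> n ` gate_set n a b)"
      using generate.one[of "Cliff_mod n" "proj_class \<omega> n ` gate_set n a b"] by (auto intro: generate.incl)
    moreover have "subgroup (generate (Cliff_mod n) (proj_class \<omega> n ` gate_set n a b)) (Cliff_mod n)"
      using K by (intro H.generate_is_subgroup) (auto simp: Cliff_mod_carrier)
    ultimately show "generate (Cliff_mod n) (proj_class \<omega> n ` ?K) \<subseteq> generate (Cliff_mod n) (proj_class \<omega> n ` gate_set n a b)"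
      by (rule H.generate_subgroup_incl)
    show "generate (Cliff_mod n) (proj_class \<omega> n ` gate_set n a b) \<subseteq> generate (Cliff_mod n) (proj_class \<omega> n ` ?K)"
      by (rule H.mono_generate) auto
  qed
  finally show ?thesis .
qed

definition block_diagonal :: "nat \<Rightarrow> complex mat set" where
  "block_diagonal d = {block_diag A D | A D. A \<in> unitary d \<and> D \<in> unitary d}"

lemma block_diagonal_subgroup: "subgroup (block_diagonal d) (unitary_group (2 * d))"
proof (rule unitary_group.subgroupI)
  show "block_diagonal d \<subseteq> unitary (2 * d)"
    by (auto simp: block_diagonal_def block_unitary_iff)
  show "block_diagonal d \<noteq> {}"
    unfolding block_diagonal_def using unitary_one by blast
  fix U V assume U: "U \<in> block_diagonal d"
  then obtain A D where AD: "U = block_diag A D" "A \<in> unitary d" "D \<in> unitary d"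
    by (auto simp: block_diagonal_def)
  have "inv\<^bsub>unitary_group (2 * d)\<^esub> U = block_diag (A\<^sup>\<dagger>) (D\<^sup>\<dagger>)"
    using AD by (simp add: unitary_inv block_unitary_iff block_adjoint[of _ d])
  then show "inv\<^bsub>unitary_group (2 * d)\<^esub> U \<in> block_diagonal d"
    using AD unitary_adjoint unfolding block_diagonal_def by blast
  assume "V \<in> block_diagonal d"
  then obtain A' D' where AD': "V = block_diag A' D'" "A' \<in> unitary d" "D' \<in> unitary d"
    by (auto simp: block_diagonal_def)
  have "U \<otimes>\<^bsub>unitary_group (2 * d)\<^esub> V = block_diag (A * A') (D * D')"
    using AD AD' by (simp add: block_mult[of _ d])
  then show "U \<otimes>\<^bsub>unitary_group (2 * d)\<^esub> V \<in> block_diagonal d"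
    using AD AD' unitary_mult unfolding block_diagonal_def by blast
qed

text \<open>One inclusion is the factorization of block diagonal Clifford matrices; for the other, every gate
that avoids \<open>H\<close> on qubit 1 is block diagonal.\<close>
lemma block_diagonal_circuits: "clifford (Suc m) \<inter> block_diagonal (2 ^ m) = circuits (Suc m) 2 1"
proof
  show "clifford (Suc m) \<inter> block_diagonal (2 ^ m) \<subseteq> circuits (Suc m) 2 1"
    using block_diag_clifford[OF clifford_generated] by (auto simp: block_diagonal_def)
  have lift: "1\<^sub>m 2 \<otimes>\<^sub>k V \<in> block_diagonal (2 ^ m)" if "V \<in> unitary (2 ^ m)" for V
    using that by (auto simp: lift_block[OF unitary_carrier_mat] block_diagonal_def)
  have gates: "on_qubit m i H_gate \<in> unitary (2 ^ m)" "on_qubit m i (S_gate \<omega>) \<in> unitary (2 ^ m)"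
    if "i \<in> {1..m}" for i
    using that by (auto intro!: circuits_unitary[of 1 1] circuits_gates)
  have pairs: "on_qubit_pair m i CZ_gate \<in> unitary (2 ^ m)" if "i \<in> {1..m - 1}" for i
    using circuits_unitary[OF _ _ circuits_gates(3)[OF that, of 1 1]] by simp
  have "on_qubit (Suc m) i H_gate \<in> block_diagonal (2 ^ m)" if "i \<in> {2..Suc m}" for i
  proof -
    from that obtain j where "i = Suc j" "j \<in> {1..m}" by (cases i) auto
    then show ?thesis using lift[OF gates(1)] by (simp add: on_qubit_Suc)
  qed
  moreover have "on_qubit (Suc m) i (S_gate \<omega>) \<in> block_diagonal (2 ^ m)" if "i \<in> {1..Suc m}" for i
  proof (cases "i = 1")
    case True
    have "w \<cdot>\<^sub>m 1\<^sub>m (2 ^ m) \<in> unitary (2 ^ m)" using unitary_smult[OF unitary_one phase_cmod[OF w_phase]] .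
    then have "S_gate \<omega> \<otimes>\<^sub>k 1\<^sub>m (2 ^ m) \<in> block_diagonal (2 ^ m)"
      unfolding S_first_block block_diagonal_def using unitary_one by blast
    then show ?thesis by (simp only: True on_qubit_first)
  next
    case False
    with that obtain j where "i = Suc j" "j \<in> {1..m}" by (cases i) auto
    then show ?thesis using lift[OF gates(2)] by (simp add: on_qubit_Suc)
  qed
  moreover have "on_qubit_pair (Suc m) i CZ_gate \<in> block_diagonal (2 ^ m)" if "i \<in> {1..m}" for i
  proof (cases "i = 1")
    case True
    with that obtain k where k: "m = Suc k" by (cases m) auto
    have "Z_gate \<otimes>\<^sub>k 1\<^sub>m (2 ^ k) \<in> unitary (2 ^ m)" using pauli_unitary[OF Z_first(1)] k by simp
    then show ?thesis
      unfolding True k on_qubit_pair_first block_diagonal_def using unitary_one by blast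
  next
    case False
    with that obtain j where "i = Suc j" "j \<in> {1..m - 1}" by (cases i) auto
    then show ?thesis using lift[OF pairs] by (simp add: on_qubit_Suc)
  qed
  moreover have "c \<cdot>\<^sub>m 1\<^sub>m (2 ^ Suc m) \<in> block_diagonal (2 ^ m)" if "cmod c = 1" for c
    using lift[OF unitary_smult[OF unitary_one that]] by (simp add: kron_smult_right kron_one_one)
  ultimately have "gate_set (Suc m) 2 1 \<union> unit_scalars (Suc m) \<subseteq> block_diagonal (2 ^ m)"
    by (auto simp: gate_set_def unit_scalars_def)
  then have "circuits (Suc m) 2 1 \<subseteq> block_diagonal (2 ^ m)"
    unfolding circuits_def
    using unitary_group.generate_subgroup_incl[OF _ block_diagonal_subgroup, of _ "2 ^ m"] by simp
  then show "circuits (Suc m) 2 1 \<subseteq> clifford (Suc m) \<inter> block_diagonal (2 ^ m)"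
    using circuits_clifford[of 2 1 "Suc m"] by auto
qed

section \<open>The centralizer of the phase gate\<close>

text \<open>Two classes commute exactly when representatives commute up to a scalar.\<close>
lemma commuting_class_cases:
  assumes G: "mat2 1 0 0 a \<otimes>\<^sub>k 1\<^sub>m (2 ^ m) \<in> clifford (Suc m)" and a: "a \<noteq> 1" "a \<noteq> 0"
    and U: "U \<in> clifford (Suc m)"
    and comm: "proj_class \<omega> (Suc m) U \<in> centralizer (Cliff_mod (Suc m)) (proj_class \<omega> (Suc m) (mat2 1 0 0 a \<otimes>\<^sub>k 1\<^sub>m (2 ^ m)))"
  obtains "U \<in> block_diagonal (2 ^ m)"
  | B C where "B \<in> unitary (2 ^ m)" "C \<in> unitary (2 ^ m)" "U = block_anti B C" "a * a = 1"
proof -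
  let ?G = "mat2 1 0 0 a \<otimes>\<^sub>k 1\<^sub>m (2 ^ m)"
  have "proj_class \<omega> (Suc m) (U * ?G) = proj_class \<omega> (Suc m) (?G * U)"
    using comm by (simp add: centralizer_def proj_class_mult[OF G U] proj_class_mult[OF U G] del: mult_FactGroup)
  then obtain c where c: "U * ?G = c \<cdot>\<^sub>m (?G * U)"
    using clifford_mult[OF U G] clifford_mult[OF G U] by (rule proj_class_eqD)
  have "U \<in> unitary (2 * 2 ^ m)" using cliffordD(1)[OF U] by simp
  then show thesis
  proof (rule commute_first_qubit_cases[OF _ _ a c])
    fix A D assume "A \<in> unitary (2 ^ m)" "D \<in> unitary (2 ^ m)" "U = block_diag A D"
    then show thesis by (intro that(1)) (auto simp: block_diagonal_def)
  next
    fix B C assume "B \<in> unitary (2 ^ m)" "C \<in> unitary (2 ^ m)" "U = block_anti B C" "a * a = 1"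
    then show thesis by (rule that(2))
  qed simp
qed

lemma block_diagonal_commute:
  assumes "U \<in> block_diagonal d"
  shows "(mat2 1 0 0 a \<otimes>\<^sub>k 1\<^sub>m d) * U = U * (mat2 1 0 0 a \<otimes>\<^sub>k 1\<^sub>m d)"
proof -
  obtain A D where AD: "A \<in> unitary d" "D \<in> unitary d" "U = block_diag A D"
    using assms by (auto simp: block_diagonal_def)
  have c: "A \<in> carrier_mat d d" "D \<in> carrier_mat d d" using AD by auto
  show ?thesis
    using c by (simp add: AD(3) kron_block[of _ d] block_mult[of _ d]
        mult_smult_distrib[of _ d d _ d] mult_smult_assoc_mat[of _ d d _ d])
qed

lemma S_first: "mat2 1 0 0 w \<otimes>\<^sub>k 1\<^sub>m (2 ^ m) \<in> clifford (Suc m)"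
    "s_cls \<omega> (Suc m) 1 = proj_class \<omega> (Suc m) (mat2 1 0 0 w \<otimes>\<^sub>k 1\<^sub>m (2 ^ m))"
  using clifford_first_qubit[OF S_local(1,2)] 
  by (simp_all only: s_cls_def on_qubit_first gate_mat2)

text \<open>For \<open>S\<close> the antidiagonal case is excluded, because \<open>\<omega>\<^sup>2\<close> does not square to \<open>1\<close>.\<close>
lemma centralizer_s:
  "centralizer (Cliff_mod (Suc m)) (s_cls \<omega> (Suc m) 1) =
    proj_class \<omega> (Suc m) ` (clifford (Suc m) \<inter> block_diagonal (2 ^ m))"
proof
  have "v \<noteq> 1 \<and> v \<noteq> 0 \<and> v * v \<noteq> 1" if "v * v = -1" for v :: complex
    using that by auto
  from this[OF w_square] have w: "w \<noteq> 1" "w \<noteq> 0" "w * w \<noteq> 1" by blast+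
  show "centralizer (Cliff_mod (Suc m)) (s_cls \<omega> (Suc m) 1) \<subseteq>
      proj_class \<omega> (Suc m) ` (clifford (Suc m) \<inter> block_diagonal (2 ^ m))"
  proof
    fix x assume x: "x \<in> centralizer (Cliff_mod (Suc m)) (s_cls \<omega> (Suc m) 1)"
    then have "x \<in> carrier (Cliff_mod (Suc m))" by (simp add: centralizer_def)
    then obtain U where U: "U \<in> clifford (Suc m)" "x = proj_class \<omega> (Suc m) U"
      by (auto simp: Cliff_mod_carrier)
    from x have "U \<in> block_diagonal (2 ^ m)"
      unfolding U(2) S_first(2) by (rule commuting_class_cases[OF S_first(1) w(1,2) U(1)]) (use w in auto)
    with U show "x \<in> proj_class \<omega> (Suc m) ` (clifford (Suc m) \<inter> block_diagonal (2 ^ m))" by blast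
  qed
  show "proj_class \<omega> (Suc m) ` (clifford (Suc m) \<inter> block_diagonal (2 ^ m)) \<subseteq>
      centralizer (Cliff_mod (Suc m)) (s_cls \<omega> (Suc m) 1)"
    unfolding S_first(2) centralizer_def
    by (auto simp: Cliff_mod_carrier proj_class_mult[OF S_first(1)] proj_class_mult[OF _ S_first(1)]
        block_diagonal_commute simp del: mult_FactGroup)
qed

text \<open>The square of \<open>S\<close> is \<open>Z\<close>, whose class commutes only with classes of block diagonal and block
antidiagonal matrices. Conjugation by either kind preserves block diagonal matrices; the second kind
exchanges the two blocks.\<close>
lemma centralizer_s_normal:
  "centralizer (Cliff_mod (Suc m)) (s_cls \<omega> (Suc m) 1) \<lhd>
    (Cliff_mod (Suc m))\<lparr>carrier := centralizer (Cliff_mod (Suc m)) (s_cls \<omega> (Suc m) 1 \<otimes>\<^bsub>Cliff_mod (Suc m)\<^esub> s_cls \<omega> (Suc m) 1)\<rparr>"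
proof -
  let ?n = "Suc m" and ?\<pi> = "proj_class \<omega> (Suc m)" and ?s = "s_cls \<omega> (Suc m) 1" and ?d = "2 ^ m :: nat"
  let ?Z = "mat2 1 0 0 (-1) \<otimes>\<^sub>k 1\<^sub>m ?d" and ?S = "mat2 1 0 0 w \<otimes>\<^sub>k 1\<^sub>m ?d"
  interpret Q: group "Cliff_mod ?n" by (rule Cliff_mod_group)
  interpret proj: group_hom "Cliff_mat ?n" "Cliff_mod ?n" ?\<pi> by (rule proj_hom)
  have s: "?s \<in> carrier (Cliff_mod ?n)" using S_first Cliff_mod_carrier by auto
  have SS: "?S * ?S = ?Z"
    using w_square by (simp add: kron_mult[of _ _ _ ?d] mat2_mult)
  then have ss: "?s \<otimes>\<^bsub>Cliff_mod ?n\<^esub> ?s = ?\<pi> ?Z"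
    using proj_class_mult[OF S_first(1) S_first(1)] by (simp only: S_first(2) SS)
  have Z: "?Z \<in> clifford ?n" using clifford_mult[OF S_first(1)[of m] S_first(1)[of m]] by (simp only: SS)
  let ?C = "centralizer (Cliff_mod ?n) (?s \<otimes>\<^bsub>Cliff_mod ?n\<^esub> ?s)"
  have C: "subgroup ?C (Cliff_mod ?n)" using s by (intro Q.centralizer_subgroup) (rule Q.m_closed)
  have sub: "centralizer (Cliff_mod ?n) ?s \<subseteq> ?C"
  proof
    fix x assume "x \<in> centralizer (Cliff_mod ?n) ?s"
    then have x: "x \<in> carrier (Cliff_mod ?n)" "?s \<otimes>\<^bsub>Cliff_mod ?n\<^esub> x = x \<otimes>\<^bsub>Cliff_mod ?n\<^esub> ?s"
      by (auto simp: centralizer_def simp del: mult_FactGroup)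
    then show "x \<in> ?C"
      using s Q.m_assoc unfolding centralizer_def by (metis (mono_tags, lifting) mem_Collect_eq)
  qed
  interpret C: group "(Cliff_mod ?n)\<lparr>carrier := ?C\<rparr>" using Q.subgroup_imp_group[OF C] .
  show ?thesis
  proof (rule C.normal_invI)
    show "subgroup (centralizer (Cliff_mod ?n) ?s) ((Cliff_mod ?n)\<lparr>carrier := ?C\<rparr>)"
      using Q.subgroup_incl[OF Q.centralizer_subgroup[OF s] C sub] .
    fix x h assume "x \<in> carrier ((Cliff_mod ?n)\<lparr>carrier := ?C\<rparr>)" and h: "h \<in> centralizer (Cliff_mod ?n) ?s"
    then have x: "x \<in> ?C" by simp
    then have "x \<in> carrier (Cliff_mod ?n)" by (simp add: centralizer_def)
    then obtain U where U: "U \<in> clifford ?n" "x = ?\<pi> U" by (auto simp: Cliff_mod_carrier)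
    obtain V where V: "V \<in> clifford ?n" "V \<in> block_diagonal ?d" "h = ?\<pi> V"
      using h unfolding centralizer_s by blast
    obtain A D where AD: "A \<in> unitary ?d" "D \<in> unitary ?d" "V = block_diag A D"
      using V(2) by (auto simp: block_diagonal_def)
    have UVU: "U * V * U\<^sup>\<dagger> \<in> clifford ?n"
      using U V by (intro clifford_mult clifford_adjoint)
    have "x \<otimes>\<^bsub>Cliff_mod ?n\<^esub> h \<otimes>\<^bsub>Cliff_mod ?n\<^esub> inv\<^bsub>Cliff_mod ?n\<^esub> x = ?\<pi> (U * V * U\<^sup>\<dagger>)"
    proof -
      have "inv\<^bsub>Cliff_mod ?n\<^esub> (?\<pi> U) = ?\<pi> (U\<^sup>\<dagger>)" using U(1) proj.hom_inv[of U] by (simp add: Cliff_mat_inv)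
      with U(1) V(1) show ?thesis
        by (simp only: U(2) V(3) proj_class_mult clifford_mult clifford_adjoint)
    qed
    moreover have "U * V * U\<^sup>\<dagger> \<in> block_diagonal ?d"
    proof (rule commuting_class_cases[OF Z _ _ U(1)])
      show "?\<pi> U \<in> centralizer (Cliff_mod ?n) (?\<pi> ?Z)"
        using x by (simp only: U(2) ss)
    next
      assume "U \<in> block_diagonal ?d"
      then obtain B C where "B \<in> unitary ?d" "C \<in> unitary ?d" "U = block_diag B C"
        by (auto simp: block_diagonal_def)
      then have "U * V * U\<^sup>\<dagger> = block_diag (B * A * B\<^sup>\<dagger>) (C * D * C\<^sup>\<dagger>)"
        "B * A * B\<^sup>\<dagger> \<in> unitary ?d" "C * D * C\<^sup>\<dagger> \<in> unitary ?d"
        using AD unitary_carrier_mat[OF unitary_mult]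
        by (simp_all add: block_mult[of _ ?d] block_adjoint[of _ ?d])
      then show "U * V * U\<^sup>\<dagger> \<in> block_diagonal ?d" unfolding block_diagonal_def by blast
    next
      fix B C assume "B \<in> unitary ?d" "C \<in> unitary ?d" "U = block_anti B C"
      then have "U * V * U\<^sup>\<dagger> = block_diag (B * D * B\<^sup>\<dagger>) (C * A * C\<^sup>\<dagger>)"
        "B * D * B\<^sup>\<dagger> \<in> unitary ?d" "C * A * C\<^sup>\<dagger> \<in> unitary ?d"
        using AD unitary_carrier_mat[OF unitary_mult]
        by (simp_all add: block_mult[of _ ?d] block_adjoint[of _ ?d])
      then show "U * V * U\<^sup>\<dagger> \<in> block_diagonal ?d" unfolding block_diagonal_def by blast
    qed simp_all
    ultimately have "x \<otimes>\<^bsub>Cliff_mod ?n\<^esub> h \<otimes>\<^bsub>Cliff_mod ?n\<^esub> inv\<^bsub>Cliff_mod ?n\<^esub> x \<in> centralizer (Cliff_mod ?n) ?s"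
      unfolding centralizer_s using UVU by blast
    moreover have "inv\<^bsub>(Cliff_mod ?n)\<lparr>carrier := ?C\<rparr>\<^esub> x = inv\<^bsub>Cliff_mod ?n\<^esub> x"
      using Q.m_inv_consistent[OF C x] .
    ultimately show "x \<otimes>\<^bsub>(Cliff_mod ?n)\<lparr>carrier := ?C\<rparr>\<^esub> h \<otimes>\<^bsub>(Cliff_mod ?n)\<lparr>carrier := ?C\<rparr>\<^esub>
        inv\<^bsub>(Cliff_mod ?n)\<lparr>carrier := ?C\<rparr>\<^esub> x \<in> centralizer (Cliff_mod ?n) ?s"
      by (simp del: mult_FactGroup)
  qed
qed

lemma centralizer_s_generated:
  "centralizer (Cliff_mod (Suc m)) (s_cls \<omega> (Suc m) 1) = generate (Cliff_mod (Suc m)) (proj_class \<omega> (Suc m) ` gate_set (Suc m) 2 1)"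
  unfolding centralizer_s block_diagonal_circuits by (rule proj_class_circuits) auto

lemma proj_class_gate_set:
  "proj_class \<omega> n ` gate_set n a b = {h_cls \<omega> n i | i. i \<in> {a..n}} \<union> {s_cls \<omega> n i | i. i \<in> {b..n}}
     \<union> {cz_cls \<omega> n i | i. i \<in> {1..n - 1}}"
  unfolding gate_set_def h_cls_def s_cls_def cz_cls_def by blast

end

theorem theorem6p2:
  fixes \<omega> :: complex and n :: nat
  assumes "primitive_unity_root 8 \<omega>" and "n \<ge> 1"
  shows
    "(n = 1 \<longrightarrow>
        centralizer (proj_cliff \<omega> n) (s_cls \<omega> n 1) = generate (proj_cliff \<omega> n) {s_cls \<omega> n 1}) \<and>
     (n \<ge> 2 \<longrightarrow>
        centralizer (proj_cliff \<omega> n) (s_cls \<omega> n 1) =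
        generate (proj_cliff \<omega> n)
          ({h_cls \<omega> n i | i. i \<in> {2..n}} \<union> {s_cls \<omega> n i | i. i \<in> {1..n}}
           \<union> {cz_cls \<omega> n i | i. i \<in> {1..n - 1}})) \<and>
     centralizer (proj_cliff \<omega> n) (s_cls \<omega> n 1) \<lhd>
       (proj_cliff \<omega> n)\<lparr>carrier :=
          centralizer (proj_cliff \<omega> n) (s_cls \<omega> n 1 [^]\<^bsub>proj_cliff \<omega> n\<^esub> (2::nat))\<rparr> \<and>
     (n \<ge> 2 \<longrightarrow>
        centralizer (proj_cliff \<omega> n) (s_cls \<omega> n 1) =
        generate (proj_cliff \<omega> n)
          ({h_cls \<omega> n i | i. i \<in> {2..n}} \<union> {s_cls \<omega> n i | i. i \<in> {2..n}}
           \<union> {cz_cls \<omega> n i | i. i \<in> {1..n - 1}}))"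
proof -
  interpret eighth_root \<omega> by standard (rule assms(1))
  obtain m where m: "n = Suc m" using assms(2) by (cases n) auto
  let ?P = "proj_cliff \<omega> n" and ?s = "s_cls \<omega> n 1"
  have cent: "centralizer ?P x = centralizer (Cliff_mod n) x" for x
    by (simp only: proj_cliff_eq centralizer_opposite)
  have gen: "generate ?P K = generate (Cliff_mod n) K" for K
    by (simp only: proj_cliff_eq generate_opposite)
  have s: "?s \<in> carrier (Cliff_mod n)"
    using S_first[of m] Cliff_mod_carrier[of n] by (auto simp: m)
  have square: "?s [^]\<^bsub>?P\<^esub> (2::nat) = ?s \<otimes>\<^bsub>Cliff_mod n\<^esub> ?s"
  proof -
    interpret P: group ?P unfolding proj_cliff_eq by (rule group_opposite[OF Cliff_mod_group])
    have "?s \<in> carrier ?P" using s by (simp add: proj_cliff_eq)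
    then have "?s [^]\<^bsub>?P\<^esub> (2::nat) = ?s \<otimes>\<^bsub>?P\<^esub> ?s" by (simp add: numeral_2_eq_2)
    then show ?thesis by (simp add: proj_cliff_eq del: mult_FactGroup)
  qed
  have main: "centralizer ?P ?s = generate ?P ({h_cls \<omega> n i | i. i \<in> {2..n}} \<union> {s_cls \<omega> n i | i. i \<in> {1..n}}
           \<union> {cz_cls \<omega> n i | i. i \<in> {1..n - 1}})"
    using centralizer_s_generated[of m] by (simp only: cent gen m[symmetric] proj_class_gate_set)
  have "centralizer ?P ?s = generate ?P {?s}" if "n = 1"
  proof -
    have "{h_cls \<omega> n i | i. i \<in> {2..n}} \<union> {s_cls \<omega> n i | i. i \<in> {1..n}} \<union> {cz_cls \<omega> n i | i. i \<in> {1..n - 1}} = {?s}"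
      using that by auto
    with main show ?thesis by simp
  qed
  moreover have "centralizer ?P ?s \<lhd> ?P\<lparr>carrier := centralizer ?P (?s [^]\<^bsub>?P\<^esub> (2::nat))\<rparr>"
    using normal_opposite[OF centralizer_s_normal[of m]] unfolding square cent
    by (simp only: m[symmetric] proj_cliff_eq opposite_carrier_update)
  moreover have "centralizer ?P ?s = generate ?P ({h_cls \<omega> n i | i. i \<in> {2..n}} \<union> {s_cls \<omega> n i | i. i \<in> {2..n}}
           \<union> {cz_cls \<omega> n i | i. i \<in> {1..n - 1}})" if "n \<ge> 2"
  proof -
    from that obtain k where k: "n = Suc (Suc k)" using m by (cases m) auto
    have "centralizer (Cliff_mod n) ?s = proj_class \<omega> n ` circuits n 2 2"
      using centralizer_s[of m] block_diagonal_circuits[of m] S_first_omitted[of k] by (simp only: m[symmetric] k[symmetric])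
    also have "\<dots> = generate (Cliff_mod n) (proj_class \<omega> n ` gate_set n 2 2)"
      by (rule proj_class_circuits) auto
    finally show ?thesis by (simp only: cent gen proj_class_gate_set)
  qed
  ultimately show ?thesis using main by blast
qed

end
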